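(* Let $\mathfrak A$ be a Banach algebra, let $\mathcal A$ and $\mathcal B$ be Banach algebras which are Banach $\mathfrak A$-modules, and let $\mathcal M$ be a Banach $\mathcal A,\mathcal B$-module and a Banach $\mathfrak A$-bimodule with compatible actions. Then the triangular Banach algebra $\mathcal T=\begin{bmatrix}\mathcal A&\mathcal M\\&\mathcal B\end{bmatrix}$ is module Arens regular (as a $\mathfrak T$-bimodule) if and only if $\mathcal A$ and $\mathcal B$ are module Arens regular (as Banach $\mathfrak A$-bimodules) and $\mathcal A$ and $\mathcal B$ act module regularly on $\mathcal M$.
   Context: A Banach algebra $\mathcal A$ is called a Banach $\mathfrak A$-module (with compatible actions) if it is a Banach $\mathfrak A$-bimodule with $\alpha\cdot(ab)=(\alpha\cdot a)b$ and $(ab)\cdot\alpha=a(b\cdot\alpha)$ for all $a,b\in\mathcal A$, $\alpha\in\mathfrak A$. A Banach $\mathcal A,\mathcal B$-module $\mathcal M$ is a left Banach $\mathcal A$-module and right Banach $\mathcal B$-module with $(a\cdot m)\cdot b=a\cdot(m\cdot b)$. Compatibility with the $\mathfrak A$-bimodule structure means $\alpha\cdot(a\cdot m)=(\alpha\cdot a)\cdot m$, $(\alpha\cdot m)\cdot b=\alpha\cdot(m\cdot b)$, $m\cdot(b\cdot\alpha)=(m\cdot b)\cdot\alpha$, $(a\cdot m)\cdot\alpha=a\cdot(m\cdot\alpha)$. $\mathcal T=\left\{\begin{bmatrix}a&m\\&b\end{bmatrix}:a\in\mathcal A,m\in\mathcal M,b\in\mathcal B\right\}$ has the usual $2\times 2$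 matrix operations and norm $\|a\|+\|m\|+\|b\|$; $\mathfrak T=\left\{\begin{bmatrix}\alpha&\\&\alpha\end{bmatrix}:\alpha\in\mathfrak A\right\}$ acts on $\mathcal T$ entrywise on both sides. $J_{\mathcal A}$ is the closed ideal of $\mathcal A$ generated by the elements $(a\cdot\alpha)b-a(\alpha\cdot b)$ ($a,b\in\mathcal A$, $\alpha\in\mathfrak A$); $J_{\mathcal B}$, and $J_{\mathcal T}$ (with $\mathfrak T$ in place of $\mathfrak A$), are defined similarly. $J_{\mathcal M}$ is the closed subspace of $\mathcal M$ generated by the elements $a\cdot(\alpha\cdot m)-(a\cdot\alpha)\cdot m$ and $m\cdot(\alpha\cdot b)-(m\cdot\alpha)\cdot b$ ($a\in\mathcal A,b\in\mathcal B,m\in\mathcal M,\alpha\in\mathfrak A$). For a subspace $J$ of $X$, $J^{\perp\perp}\subseteq X^{**}$ is the annihilator of $J^\perp\subseteq X^*$. First and second Arens products: if $\Gamma_1=w^*\text{-}\lim_i a_{1,i}$ and $\Gamma_2=w^*\text{-}\lim_j a_{2,j}$ in $\mathcal A^{**}$ with nets in $\mathcal A$, then $\Gamma_1\Box\Gamma_2=w^*\text{-}\lim_i\lim_j a_{1,i}a_{2,j}$ and $\Gamma_1\diamond\Gamma_2=w^*\text{-}\lim_j\lim_i a_{1,i}a_{2,j}$; similarly on $\mathcal B^{**}$ and $\mathcal T^{**}$. For $\Gamma=w^*\text{-}\lim_i a_i\in\mathcal A^{**}$, $\Psi=w^*\text{-}\lim_j b_j\in\mathcal B^{**}$, $\Pi=w^*\text{-}\lim_k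 x_k\in\mathcal M^{**}$: $\Gamma\Box\Pi=w^*\text{-}\lim_i\lim_k a_i\cdot x_k$, $\Pi\Box\Psi=w^*\text{-}\lim_k\lim_j x_k\cdot b_j$, $\Gamma\diamond\Pi=w^*\text{-}\lim_k\lim_i a_i\cdot x_k$, $\Pi\diamond\Psi=w^*\text{-}\lim_j\lim_k x_k\cdot b_j$. $\mathcal A$ is module Arens regular (as a Banach $\mathfrak A$-module) if $\Gamma_1\Box\Gamma_2-\Gamma_1\diamond\Gamma_2\in J_{\mathcal A}^{\perp\perp}$ for all $\Gamma_1,\Gamma_2\in\mathcal A^{**}$; likewise for $\mathcal B$, and for $\mathcal T$ as a $\mathfrak T$-bimodule using $J_{\mathcal T}$. $\mathcal A$ and $\mathcal B$ act module regularly on $\mathcal M$ if $\Gamma\Box\Pi-\Gamma\diamond\Pi\in J_{\mathcal M}^{\perp\perp}$ and $\Pi\Box\Psi-\Pi\diamond\Psi\in J_{\mathcal M}^{\perp\perp}$ for all $\Gamma\in\mathcal A^{**},\Psi\in\mathcal B^{**},\Pi\in\mathcal M^{**}$. *)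

theory Defs
  imports "HOL-Analysis.Analysis"
begin

section \<open>Banach spaces, Banach algebras and Banach modules\<close>

text \<open>The scalar field is a type of class \<^class>\<open>real_normed_field\<close>, that is (by
  Gelfand--Mazur) the real or the complex numbers. The type class \<^class>\<open>banach\<close> only
  provides real scalars, so the scalar multiplication by the field is an explicit argument.\<close>

locale banach_space = vector_space scale
  for scale :: "'k::real_normed_field \<Rightarrow> 'x::banach \<Rightarrow> 'x" +
  assumes scale_of_real: "scale (of_real r) x = r *\<^sub>R x"
    and norm_scale: "norm (scale c x) = norm c * norm x"

locale bounded_bilinear_over = bounded_bilinear f
  for sX :: "'k::real_normed_field \<Rightarrow> 'x::banach \<Rightarrow> 'x"
    and sY :: "'k \<Rightarrow> 'y::banach \<Rightarrow> 'y"
    and sZ :: "'k \<Rightarrow> 'z::banach \<Rightarrow> 'z"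
    and f :: "'x \<Rightarrow> 'y \<Rightarrow> 'z" +
  assumes scale_left: "f (sX c x) y = sZ c (f x y)"
    and scale_right: "f x (sY c y) = sZ c (f x y)"

locale banach_algebra = banach_space s + bounded_bilinear_over s s s mul
  for s :: "'k::real_normed_field \<Rightarrow> 'a::banach \<Rightarrow> 'a"
    and mul :: "'a \<Rightarrow> 'a \<Rightarrow> 'a" +
  assumes assoc: "mul (mul a b) c = mul a (mul b c)"
    and norm_mult_le: "norm (mul a b) \<le> norm a * norm b"

text \<open>Module actions are bounded bilinear maps; they need not be contractive. A right action
  takes the module element first.\<close>

locale banach_left_module =
  alg: banach_algebra sA mA + sp: banach_space sX + bounded_bilinear_over sA sX sX l
  for sA :: "'k::real_normed_field \<Rightarrow> 'a::banach \<Rightarrow> 'a" and mA :: "'a \<Rightarrow> 'a \<Rightarrow> 'a"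
    and sX :: "'k \<Rightarrow> 'x::banach \<Rightarrow> 'x" and l :: "'a \<Rightarrow> 'x \<Rightarrow> 'x" +
  assumes left_assoc: "l (mA a b) x = l a (l b x)"

locale banach_right_module =
  alg: banach_algebra sB mB + sp: banach_space sX + bounded_bilinear_over sX sB sX r
  for sB :: "'k::real_normed_field \<Rightarrow> 'b::banach \<Rightarrow> 'b" and mB :: "'b \<Rightarrow> 'b \<Rightarrow> 'b"
    and sX :: "'k \<Rightarrow> 'x::banach \<Rightarrow> 'x" and r :: "'x \<Rightarrow> 'b \<Rightarrow> 'x" +
  assumes right_assoc: "r x (mB a b) = r (r x a) b"

locale banach_bimodule =
  left: banach_left_module sA mA sX l + right: banach_right_module sB mB sX r
  for sA :: "'k::real_normed_field \<Rightarrow> 'a::banach \<Rightarrow> 'a" and mA :: "'a \<Rightarrow> 'a \<Rightarrow> 'a"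
    and sB :: "'k \<Rightarrow> 'b::banach \<Rightarrow> 'b" and mB :: "'b \<Rightarrow> 'b \<Rightarrow> 'b"
    and sX :: "'k \<Rightarrow> 'x::banach \<Rightarrow> 'x" and l :: "'a \<Rightarrow> 'x \<Rightarrow> 'x" and r :: "'x \<Rightarrow> 'b \<Rightarrow> 'x" +
  assumes middle_assoc: "r (l a x) b = l a (r x b)"

text \<open>A Banach algebra \<open>A\<close> that is a Banach module over the Banach algebra \<open>R\<close> with compatible
  actions \<open>l\<close> and \<open>r\<close>.\<close>

locale banach_module_algebra =
  A: banach_algebra sA mA + banach_bimodule sR mR sR mR sA l r
  for sR :: "'k::real_normed_field \<Rightarrow> 'r::banach \<Rightarrow> 'r" and mR :: "'r \<Rightarrow> 'r \<Rightarrow> 'r"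
    and sA :: "'k \<Rightarrow> 'a::banach \<Rightarrow> 'a" and mA :: "'a \<Rightarrow> 'a \<Rightarrow> 'a"
    and l :: "'r \<Rightarrow> 'a \<Rightarrow> 'a" and r :: "'a \<Rightarrow> 'r \<Rightarrow> 'a" +
  assumes left_compat: "l \<alpha> (mA a b) = mA (l \<alpha> a) b"
    and right_compat: "r (mA a b) \<alpha> = mA a (r b \<alpha>)"

text \<open>The setting of a triangular Banach algebra: \<open>lA\<close>, \<open>rA\<close>, \<open>lB\<close>, \<open>rB\<close>, \<open>lM\<close>, \<open>rM\<close> are the actions
  of \<open>R\<close>, while \<open>aM\<close> and \<open>bM\<close> are the left action of \<open>A\<close> and the right action of \<open>B\<close> on \<open>M\<close>.\<close>

locale triangular_setting =
  A: banach_module_algebra sR mR sA mA lA rA +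
  B: banach_module_algebra sR mR sB mB lB rB +
  M: banach_bimodule sA mA sB mB sM aM bM +
  MR: banach_bimodule sR mR sR mR sM lM rM
  for sR :: "'k::real_normed_field \<Rightarrow> 'r::banach \<Rightarrow> 'r" and mR :: "'r \<Rightarrow> 'r \<Rightarrow> 'r"
    and sA :: "'k \<Rightarrow> 'a::banach \<Rightarrow> 'a" and mA :: "'a \<Rightarrow> 'a \<Rightarrow> 'a"
    and lA :: "'r \<Rightarrow> 'a \<Rightarrow> 'a" and rA :: "'a \<Rightarrow> 'r \<Rightarrow> 'a"
    and sB :: "'k \<Rightarrow> 'b::banach \<Rightarrow> 'b" and mB :: "'b \<Rightarrow> 'b \<Rightarrow> 'b"
    and lB :: "'r \<Rightarrow> 'b \<Rightarrow> 'b" and rB :: "'b \<Rightarrow> 'r \<Rightarrow> 'b"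
    and sM :: "'k \<Rightarrow> 'm::banach \<Rightarrow> 'm"
    and aM :: "'a \<Rightarrow> 'm \<Rightarrow> 'm" and bM :: "'m \<Rightarrow> 'b \<Rightarrow> 'm"
    and lM :: "'r \<Rightarrow> 'm \<Rightarrow> 'm" and rM :: "'m \<Rightarrow> 'r \<Rightarrow> 'm" +
  assumes compat_left_A: "lM \<alpha> (aM a m) = aM (lA \<alpha> a) m"
    and compat_left_B: "bM (lM \<alpha> m) b = lM \<alpha> (bM m b)"
    and compat_right_B: "bM m (rB b \<alpha>) = rM (bM m b) \<alpha>"
    and compat_right_A: "rM (aM a m) \<alpha> = aM a (rM m \<alpha>)"


section \<open>Duals, biduals and annihilators\<close>

definition dual_space :: "('k::real_normed_field \<Rightarrow> 'x::banach \<Rightarrow> 'x) \<Rightarrow> ('x \<Rightarrow> 'k) set" where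
  "dual_space s = {f. bounded_linear f \<and> (\<forall>c x. f (s c x) = c * f x)}"

text \<open>Elements of the bidual are functions on the dual space, set to 0 outside of it.
  The norm of the dual space is the operator norm \<^const>\<open>onorm\<close>.\<close>

definition bidual_space ::
    "('k::real_normed_field \<Rightarrow> 'x::banach \<Rightarrow> 'x) \<Rightarrow> (('x \<Rightarrow> 'k) \<Rightarrow> 'k) set" where
  "bidual_space s = {\<Gamma>.
     (\<forall>f\<in>dual_space s. \<forall>g\<in>dual_space s. \<Gamma> (\<lambda>x. f x + g x) = \<Gamma> f + \<Gamma> g) \<and>
     (\<forall>c. \<forall>f\<in>dual_space s. \<Gamma> (\<lambda>x. c * f x) = c * \<Gamma> f) \<and>
     (\<exists>K. \<forall>f\<in>dual_space s. norm (\<Gamma> f) \<le> K * onorm f) \<and>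
     (\<forall>f. f \<notin> dual_space s \<longrightarrow> \<Gamma> f = 0)}"

definition annihilator ::
    "('k::real_normed_field \<Rightarrow> 'x::banach \<Rightarrow> 'x) \<Rightarrow> 'x set \<Rightarrow> ('x \<Rightarrow> 'k) set" where
  "annihilator s J = {f \<in> dual_space s. \<forall>x\<in>J. f x = 0}"

definition biannihilator ::
    "('k::real_normed_field \<Rightarrow> 'x::banach \<Rightarrow> 'x) \<Rightarrow> 'x set \<Rightarrow> (('x \<Rightarrow> 'k) \<Rightarrow> 'k) set" where
  "biannihilator s J = {\<Gamma> \<in> bidual_space s. \<forall>f\<in>annihilator s J. \<Gamma> f = 0}"


section \<open>Arens products\<close>

text \<open>A net in \<open>X\<close> enters weak-star limits only through its filter of tails on \<open>X\<close>, and every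
  proper filter on \<open>X\<close> arises from a net; so nets are represented by proper filters.\<close>

definition weak_star_lim ::
    "('k::real_normed_field \<Rightarrow> 'x::banach \<Rightarrow> 'x) \<Rightarrow> 'x filter \<Rightarrow> (('x \<Rightarrow> 'k) \<Rightarrow> 'k) \<Rightarrow> bool" where
  "weak_star_lim s F \<Gamma> \<longleftrightarrow> F \<noteq> bot \<and> (\<forall>f\<in>dual_space s. (f \<longlongrightarrow> \<Gamma> f) F)"

text \<open>\<open>iterated_weak_star_lim s p F G \<Lambda>\<close> says that \<open>\<Lambda>\<close> is the weak-star limit
  \<open>lim\<^sub>x lim\<^sub>y p x y\<close> in the bidual, where \<open>x\<close> runs along \<open>F\<close> (outer limit) and \<open>y\<close> along \<open>G\<close>.\<close>

definition iterated_weak_star_lim ::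
    "('k::real_normed_field \<Rightarrow> 'z::banach \<Rightarrow> 'z) \<Rightarrow> ('x \<Rightarrow> 'y \<Rightarrow> 'z) \<Rightarrow> 'x filter \<Rightarrow> 'y filter
      \<Rightarrow> (('z \<Rightarrow> 'k) \<Rightarrow> 'k) \<Rightarrow> bool" where
  "iterated_weak_star_lim s p F G \<Lambda> \<longleftrightarrow>
     (\<forall>h\<in>dual_space s. \<exists>L. (\<forall>x. ((\<lambda>y. h (p x y)) \<longlongrightarrow> L x) G) \<and> (L \<longlongrightarrow> \<Lambda> h) F)"

definition first_arens ::
    "('k::real_normed_field \<Rightarrow> 'x::banach \<Rightarrow> 'x) \<Rightarrow> ('k \<Rightarrow> 'y::banach \<Rightarrow> 'y) \<Rightarrow> ('k \<Rightarrow> 'z::banach \<Rightarrow> 'z)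
      \<Rightarrow> ('x \<Rightarrow> 'y \<Rightarrow> 'z) \<Rightarrow> (('x \<Rightarrow> 'k) \<Rightarrow> 'k) \<Rightarrow> (('y \<Rightarrow> 'k) \<Rightarrow> 'k) \<Rightarrow> (('z \<Rightarrow> 'k) \<Rightarrow> 'k)" where
  "first_arens sX sY sZ p \<Gamma> \<Phi> =
     (THE \<Lambda>. \<Lambda> \<in> bidual_space sZ \<and>
        (\<forall>F G. weak_star_lim sX F \<Gamma> \<longrightarrow> weak_star_lim sY G \<Phi> \<longrightarrow>
           iterated_weak_star_lim sZ p F G \<Lambda>))"

definition second_arens ::
    "('k::real_normed_field \<Rightarrow> 'x::banach \<Rightarrow> 'x) \<Rightarrow> ('k \<Rightarrow> 'y::banach \<Rightarrow> 'y) \<Rightarrow> ('k \<Rightarrow> 'z::banach \<Rightarrow> 'z)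
      \<Rightarrow> ('x \<Rightarrow> 'y \<Rightarrow> 'z) \<Rightarrow> (('x \<Rightarrow> 'k) \<Rightarrow> 'k) \<Rightarrow> (('y \<Rightarrow> 'k) \<Rightarrow> 'k) \<Rightarrow> (('z \<Rightarrow> 'k) \<Rightarrow> 'k)" where
  "second_arens sX sY sZ p \<Gamma> \<Phi> =
     (THE \<Lambda>. \<Lambda> \<in> bidual_space sZ \<and>
        (\<forall>F G. weak_star_lim sX F \<Gamma> \<longrightarrow> weak_star_lim sY G \<Phi> \<longrightarrow>
           iterated_weak_star_lim sZ (\<lambda>y x. p x y) G F \<Lambda>))"

text \<open>The nets and iterated limits above always exist, so both products are well defined.\<close>

lemma dual_space_add: "f \<in> dual_space s \<Longrightarrow> g \<in> dual_space s \<Longrightarrow> (\<lambda>x. f x + g x) \<in> dual_space s"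
  by (auto simp: dual_space_def bounded_linear_add algebra_simps)

lemma dual_space_mult: "f \<in> dual_space s \<Longrightarrow> (\<lambda>x. c * f x) \<in> dual_space s"
  by (auto simp: dual_space_def bounded_linear_const_mult algebra_simps)

lemma bidual_bound:
  assumes "\<Gamma> \<in> bidual_space s"
  shows "\<exists>K\<ge>0. \<forall>f\<in>dual_space s. norm (\<Gamma> f) \<le> K * onorm f"
proof -
  obtain K where K: "\<And>f. f \<in> dual_space s \<Longrightarrow> norm (\<Gamma> f) \<le> K * onorm f"
    using assms unfolding bidual_space_def by blast
  have "norm (\<Gamma> f) \<le> \<bar>K\<bar> * onorm f" if "f \<in> dual_space s" for f
    using K[OF that] that mult_right_mono[OF abs_ge_self[of K], of "onorm f"]
    by (force simp: dual_space_def onorm_pos_le intro: order_trans)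
  then show ?thesis by (meson abs_ge_zero)
qed

lemma bidual_in_dual_combination:
  assumes "finite S" "S \<subseteq> dual_space s" "g \<in> dual_space s" "\<Gamma> \<in> bidual_space s"
    and "\<And>x. (\<forall>f\<in>S. f x = 0) \<Longrightarrow> g x = 0" and "\<forall>f\<in>S. f x0 = \<Gamma> f"
  shows "g x0 = \<Gamma> g"
  using assms
proof (induction S arbitrary: g rule: finite_induct)
  case empty
  then have "g = (\<lambda>x. 0 * g x)" by auto
  moreover have "\<Gamma> (\<lambda>x. 0 * g x) = 0 * \<Gamma> g"
    using empty.prems unfolding bidual_space_def by blast
  ultimately show ?case using empty.prems by auto
next
  case (insert h S)
  show ?case
  proof (cases "\<exists>z. (\<forall>f\<in>S. f z = 0) \<and> h z \<noteq> 0")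
    case True
    then obtain z where z: "\<And>f. f \<in> S \<Longrightarrow> f z = 0" "h z \<noteq> 0" by blast
    define c where "c = - g z / h z"
    define g' where "g' = (\<lambda>x. g x + c * h x)"
    have dual: "h \<in> dual_space s" "S \<subseteq> dual_space s" using insert.prems by auto
    have ch: "(\<lambda>x. c * h x) \<in> dual_space s" by (rule dual_space_mult) fact
    have g': "g' \<in> dual_space s"
      unfolding g'_def using dual_space_add[OF insert.prems(2) ch] .
    have "g' x = 0" if x: "\<forall>f\<in>S. f x = 0" for x
    proof -
      define y where "y = x - s (h x / h z) z"
      have lin: "f y = f x - h x / h z * f z" if "f \<in> dual_space s" for f
        using that unfolding dual_space_def y_def by (simp add: linear_diff bounded_linear.linear)
      have "h y = 0" using lin[OF dual(1)] z(2) by simp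
      moreover have "f y = 0" if "f \<in> S" for f
      proof -
        have "f \<in> dual_space s" "f x = 0" using dual(2) x that by blast+
        then show ?thesis using lin[of f] z(1)[OF that] by simp
      qed
      ultimately have "\<forall>f\<in>insert h S. f y = 0" by blast
      then have "g y = 0" by (rule insert.prems(4))
      then show ?thesis
        using lin[OF insert.prems(2)] z(2) unfolding g'_def c_def by (simp add: field_simps)
    qed
    then have "g' x0 = \<Gamma> g'"
      using insert.IH[OF dual(2) g' insert.prems(3)] insert.prems(5) by blast
    also have "\<Gamma> g' = \<Gamma> g + \<Gamma> (\<lambda>x. c * h x)"
      unfolding g'_def using insert.prems(2,3) ch by (simp add: bidual_space_def)
    also have "\<Gamma> (\<lambda>x. c * h x) = c * \<Gamma> h"
      using insert.prems(3) dual(1) by (simp add: bidual_space_def)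
    finally show ?thesis using insert.prems(5) by (simp add: g'_def)
  next
    case False
    then have "g x = 0" if "\<forall>f\<in>S. f x = 0" for x
      using insert.prems(4)[of x] that by blast
    then show ?thesis
      using insert.IH[of g] insert.prems(1,2,3,5) by blast
  qed
qed

lemma bidual_finite_interpolation:
  assumes "banach_space s" "finite S" "S \<subseteq> dual_space s" "\<Gamma> \<in> bidual_space s"
  shows "\<exists>x. \<forall>f\<in>S. f x = \<Gamma> f"
  using assms(2,3)
proof (induction S rule: finite_induct)
  case (insert g S)
  then obtain x0 where x0: "\<forall>f\<in>S. f x0 = \<Gamma> f" by blast
  show ?case
  proof (cases "\<exists>z. (\<forall>f\<in>S. f z = 0) \<and> g z \<noteq> 0")
    case True
    then obtain z where z: "\<And>f. f \<in> S \<Longrightarrow> f z = 0" "g z \<noteq> 0" by blast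
    define x where "x = x0 + s ((\<Gamma> g - g x0) / g z) z"
    have lin: "f x = f x0 + (\<Gamma> g - g x0) / g z * f z" if "f \<in> dual_space s" for f
      using that unfolding dual_space_def x_def by (simp add: linear_add bounded_linear.linear)
    have "g \<in> dual_space s" using insert.prems by blast
    then have "g x = \<Gamma> g" using lin[of g] z(2) by simp
    moreover have "f x = \<Gamma> f" if "f \<in> S" for f
    proof -
      have "f \<in> dual_space s" "f x0 = \<Gamma> f" using insert.prems x0 that by blast+
      then show ?thesis using lin[of f] z(1)[OF that] by simp
    qed
    ultimately have "\<forall>f\<in>insert g S. f x = \<Gamma> f" by blast
    then show ?thesis ..
  next
    case False
    have "g x0 = \<Gamma> g"
    proof (rule bidual_in_dual_combination[OF insert.hyps(1) _ _ assms(4) _ x0])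
      show "S \<subseteq> dual_space s" "g \<in> dual_space s" using insert.prems by blast+
      show "g x = 0" if "\<forall>f\<in>S. f x = 0" for x using False that by blast
    qed
    then have "\<forall>f\<in>insert g S. f x0 = \<Gamma> f" using x0 by blast
    then show ?thesis ..
  qed
qed auto

lemma weak_star_lim_exists:
  assumes "banach_space s" "\<Gamma> \<in> bidual_space s"
  shows "\<exists>F. weak_star_lim s F \<Gamma>"
proof -
  define F where "F = (INF f\<in>dual_space s. principal {x. f x = \<Gamma> f})"
  have "F \<noteq> bot"
    unfolding F_def
  proof (rule INF_filter_not_bot)
    fix S assume S: "S \<subseteq> dual_space s" "finite S"
    then show "(INF f\<in>S. principal {x. f x = \<Gamma> f}) \<noteq> bot"
      using bidual_finite_interpolation[OF assms(1) S(2,1) assms(2)]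
      unfolding INF_principal_finite[OF S(2)] principal_eq_bot_iff by blast
  qed
  moreover have "(f \<longlongrightarrow> \<Gamma> f) F" if "f \<in> dual_space s" for f
  proof (rule tendsto_eventually)
    have "F \<le> principal {x. f x = \<Gamma> f}"
      unfolding F_def using that by (rule INF_lower)
    then show "eventually (\<lambda>x. f x = \<Gamma> f) F"
      by (simp add: le_principal)
  qed
  ultimately show ?thesis unfolding weak_star_lim_def by blast
qed

lemma first_arens_ex1:
  fixes sX :: "'k::real_normed_field \<Rightarrow> 'x::banach \<Rightarrow> 'x"
  assumes "banach_space sX" "banach_space sY" "bounded_bilinear_over sX sY sZ p"
    and \<Gamma>: "\<Gamma> \<in> bidual_space sX" and \<Phi>: "\<Phi> \<in> bidual_space sY"
  shows "\<exists>!\<Lambda>. \<Lambda> \<in> bidual_space sZ \<and>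
        (\<forall>F G. weak_star_lim sX F \<Gamma> \<longrightarrow> weak_star_lim sY G \<Phi> \<longrightarrow>
           iterated_weak_star_lim sZ p F G \<Lambda>)"
proof -
  interpret p: bounded_bilinear_over sX sY sZ p by fact
  have \<Gamma>add: "\<Gamma> (\<lambda>x. f x + g x) = \<Gamma> f + \<Gamma> g" if "f \<in> dual_space sX" "g \<in> dual_space sX" for f g
    using \<Gamma> that by (simp add: bidual_space_def)
  have \<Gamma>mul: "\<Gamma> (\<lambda>x. c * f x) = c * \<Gamma> f" if "f \<in> dual_space sX" for f c
    using \<Gamma> that by (simp add: bidual_space_def)
  have \<Phi>add: "\<Phi> (\<lambda>x. f x + g x) = \<Phi> f + \<Phi> g" if "f \<in> dual_space sY" "g \<in> dual_space sY" for f g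
    using \<Phi> that by (simp add: bidual_space_def)
  have \<Phi>mul: "\<Phi> (\<lambda>x. c * f x) = c * \<Phi> f" if "f \<in> dual_space sY" for f c
    using \<Phi> that by (simp add: bidual_space_def)
  obtain K1 where K1: "K1 \<ge> 0" "\<And>f. f \<in> dual_space sX \<Longrightarrow> norm (\<Gamma> f) \<le> K1 * onorm f"
    using bidual_bound[OF \<Gamma>] by blast
  obtain K2 where K2: "K2 \<ge> 0" "\<And>f. f \<in> dual_space sY \<Longrightarrow> norm (\<Phi> f) \<le> K2 * onorm f"
    using bidual_bound[OF \<Phi>] by blast
  obtain K where K: "K \<ge> 0" "\<And>x y. norm (p x y) \<le> norm x * norm y * K"
    using p.nonneg_bounded by blast
  have blD: "bounded_linear f" if "f \<in> dual_space s" for f and s :: "'k \<Rightarrow> 'd::banach \<Rightarrow> 'd"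
    using that by (simp add: dual_space_def)
  have norm_hp: "norm (h (p x y)) \<le> onorm h * norm x * K * norm y" if "h \<in> dual_space sZ" for h x y
  proof -
    have "norm (h (p x y)) \<le> onorm h * norm (p x y)" using onorm blD that by blast
    also have "\<dots> \<le> onorm h * (norm x * norm y * K)"
      using K(2) onorm_pos_le[OF blD[OF that]] by (intro mult_left_mono)
    finally show ?thesis by (simp add: algebra_simps)
  qed
  have inner: "(\<lambda>y. h (p x y)) \<in> dual_space sY" if h: "h \<in> dual_space sZ" for h x
  proof -
    have "bounded_linear (\<lambda>y. h (p x y))"
      using blD[OF h] p.bounded_linear_right by (rule bounded_linear_compose)
    then show ?thesis using h by (auto simp: dual_space_def p.scale_right)
  qed
  have inner_norm: "onorm (\<lambda>y. h (p x y)) \<le> onorm h * norm x * K" if h: "h \<in> dual_space sZ" for h x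
    by (rule onorm_bound) (use norm_hp[OF h] K(1) onorm_pos_le[OF blD[OF h]] in auto)
  define m where "m = (\<lambda>h x. \<Phi> (\<lambda>y. h (p x y)))"
  have m_norm: "norm (m h x) \<le> norm x * (K2 * onorm h * K)" if h: "h \<in> dual_space sZ" for h x
  proof -
    have "norm (m h x) \<le> K2 * onorm (\<lambda>y. h (p x y))"
      unfolding m_def by (rule K2) (rule inner[OF h])
    also have "\<dots> \<le> K2 * (onorm h * norm x * K)"
      by (intro mult_left_mono inner_norm h K2)
    finally show ?thesis by (simp add: algebra_simps)
  qed
  have m_scale: "m h (sX c x) = c * m h x" if h: "h \<in> dual_space sZ" for h c x
    using \<Phi>mul[OF inner[OF h]] h unfolding m_def by (simp add: p.scale_left dual_space_def)
  have m: "m h \<in> dual_space sX" if h: "h \<in> dual_space sZ" for h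
  proof -
    have lin: "linear h" using blD[OF h] by (rule bounded_linear.linear)
    have "bounded_linear (m h)"
    proof (rule bounded_linear_intro)
      fix x y show "m h (x + y) = m h x + m h y"
        using \<Phi>add[OF inner[OF h] inner[OF h], of x y] unfolding m_def
        by (simp add: p.add_left linear_add[OF lin])
    next
      fix r x show "m h (r *\<^sub>R x) = r *\<^sub>R m h x"
        using m_scale[OF h, of "of_real r" x] banach_space.scale_of_real[OF assms(1)]
        by (simp add: scaleR_conv_of_real)
    qed (rule m_norm[OF h])
    then show ?thesis using m_scale[OF h] by (simp add: dual_space_def)
  qed
  have m_add: "m (\<lambda>z. h z + k z) = (\<lambda>x. m h x + m k x)" if "h \<in> dual_space sZ" "k \<in> dual_space sZ" for h k
    unfolding m_def using \<Phi>add inner that by blast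
  have m_mult: "m (\<lambda>z. c * h z) = (\<lambda>x. c * m h x)" if "h \<in> dual_space sZ" for h c
    unfolding m_def using \<Phi>mul inner that by blast
  define \<Lambda> where "\<Lambda> = (\<lambda>h. if h \<in> dual_space sZ then \<Gamma> (m h) else 0)"
  have "\<Lambda> \<in> bidual_space sZ"
  proof -
    have "norm (\<Lambda> h) \<le> (K1 * K2 * K) * onorm h" if h: "h \<in> dual_space sZ" for h
    proof -
      have *: "onorm (m h) \<le> K2 * onorm h * K" (is "_ \<le> ?B")
        by (rule onorm_bound)
          (use m_norm[OF h] K(1) K2(1) onorm_pos_le[OF blD[OF h]] in \<open>auto simp: mult.commute\<close>)
      have "norm (\<Lambda> h) \<le> K1 * onorm (m h)"
        using K1(2)[OF m[OF h]] h by (simp add: \<Lambda>_def)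
      also from * have "\<dots> \<le> K1 * ?B"
        using K1(1) by (rule mult_left_mono)
      finally show ?thesis by (simp add: algebra_simps)
    qed
    then show ?thesis
      unfolding bidual_space_def
      by (auto simp: \<Lambda>_def dual_space_add dual_space_mult m_add m_mult \<Gamma>add \<Gamma>mul m)
  qed
  moreover have "iterated_weak_star_lim sZ p F G \<Lambda>"
    if "weak_star_lim sX F \<Gamma>" "weak_star_lim sY G \<Phi>" for F G
    unfolding iterated_weak_star_lim_def
  proof (intro ballI exI conjI allI)
    fix h x assume h: "h \<in> dual_space sZ"
    show "((\<lambda>y. h (p x y)) \<longlongrightarrow> m h x) G"
      using that(2) inner[OF h] unfolding weak_star_lim_def m_def by blast
    show "(m h \<longlongrightarrow> \<Lambda> h) F"
      using that(1) m[OF h] h unfolding weak_star_lim_def \<Lambda>_def by simp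
  qed
  moreover have "\<Lambda>' = \<Lambda>" if \<Lambda>': "\<Lambda>' \<in> bidual_space sZ"
    "\<forall>F G. weak_star_lim sX F \<Gamma> \<longrightarrow> weak_star_lim sY G \<Phi> \<longrightarrow> iterated_weak_star_lim sZ p F G \<Lambda>'" for \<Lambda>'
  proof
    fix h
    obtain F G where FG: "weak_star_lim sX F \<Gamma>" "weak_star_lim sY G \<Phi>"
      using weak_star_lim_exists[OF assms(1) \<Gamma>] weak_star_lim_exists[OF assms(2) \<Phi>] by blast
    then have ne: "F \<noteq> bot" "G \<noteq> bot" by (simp_all add: weak_star_lim_def)
    show "\<Lambda>' h = \<Lambda> h"
    proof (cases "h \<in> dual_space sZ")
      case True
      have "iterated_weak_star_lim sZ p F G \<Lambda>'" using \<Lambda>'(2) FG by blast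
      then obtain L where L: "\<And>x. ((\<lambda>y. h (p x y)) \<longlongrightarrow> L x) G" "(L \<longlongrightarrow> \<Lambda>' h) F"
        using True unfolding iterated_weak_star_lim_def by blast
      have "L x = m h x" for x
      proof (rule tendsto_unique[OF ne(2) L(1)])
        show "((\<lambda>y. h (p x y)) \<longlongrightarrow> m h x) G"
          using FG(2) inner[OF True] unfolding weak_star_lim_def m_def by blast
      qed
      then have "L = m h" ..
      moreover have "(m h \<longlongrightarrow> \<Lambda> h) F"
        using FG(1) m[OF True] True unfolding weak_star_lim_def \<Lambda>_def by simp
      ultimately show ?thesis
        using tendsto_unique[OF ne(1) L(2)] by simp
    next
      case False
      then show ?thesis using \<Lambda>'(1) by (simp add: \<Lambda>_def bidual_space_def)
    qed
  qed
  ultimately show ?thesis by blast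
qed

lemma second_arens_flip:
  "second_arens sX sY sZ p \<Gamma> \<Phi> = first_arens sY sX sZ (\<lambda>y x. p x y) \<Phi> \<Gamma>"
  unfolding first_arens_def second_arens_def by (intro arg_cong[where f = The] ext) blast


section \<open>Module Arens regularity\<close>

definition closed_ideal ::
    "('k::real_normed_field \<Rightarrow> 'a::banach \<Rightarrow> 'a) \<Rightarrow> ('a \<Rightarrow> 'a \<Rightarrow> 'a) \<Rightarrow> 'a set \<Rightarrow> bool" where
  "closed_ideal s mul I \<longleftrightarrow> closed I \<and> module.subspace s I \<and>
     (\<forall>x\<in>I. \<forall>a. mul a x \<in> I \<and> mul x a \<in> I)"

definition J_algebra ::
    "('k::real_normed_field \<Rightarrow> 'a::banach \<Rightarrow> 'a) \<Rightarrow> ('a \<Rightarrow> 'a \<Rightarrow> 'a) \<Rightarrow> ('r \<Rightarrow> 'a \<Rightarrow> 'a) \<Rightarrow> ('a \<Rightarrow> 'r \<Rightarrow> 'a)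
      \<Rightarrow> 'a set" where
  "J_algebra s mul l r =
     closed_ideal s mul hull {mul (r a \<alpha>) b - mul a (l \<alpha> b) | a b \<alpha>. True}"

definition J_module ::
    "('k::real_normed_field \<Rightarrow> 'm::banach \<Rightarrow> 'm) \<Rightarrow> ('a \<Rightarrow> 'm \<Rightarrow> 'm) \<Rightarrow> ('m \<Rightarrow> 'b \<Rightarrow> 'm)
      \<Rightarrow> ('a \<Rightarrow> 'r \<Rightarrow> 'a) \<Rightarrow> ('r \<Rightarrow> 'b \<Rightarrow> 'b) \<Rightarrow> ('r \<Rightarrow> 'm \<Rightarrow> 'm) \<Rightarrow> ('m \<Rightarrow> 'r \<Rightarrow> 'm) \<Rightarrow> 'm set" where
  "J_module sM aM bM rA lB lM rM =
     (\<lambda>S. closed S \<and> module.subspace sM S) hull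
       ({aM a (lM \<alpha> m) - aM (rA a \<alpha>) m | a \<alpha> m. True} \<union>
        {bM m (lB \<alpha> b) - bM (rM m \<alpha>) b | b \<alpha> m. True})"

definition module_arens_regular ::
    "('k::real_normed_field \<Rightarrow> 'a::banach \<Rightarrow> 'a) \<Rightarrow> ('a \<Rightarrow> 'a \<Rightarrow> 'a) \<Rightarrow> ('r \<Rightarrow> 'a \<Rightarrow> 'a) \<Rightarrow> ('a \<Rightarrow> 'r \<Rightarrow> 'a)
      \<Rightarrow> bool" where
  "module_arens_regular s mul l r \<longleftrightarrow>
     (\<forall>\<Gamma>\<^sub>1\<in>bidual_space s. \<forall>\<Gamma>\<^sub>2\<in>bidual_space s.
        first_arens s s s mul \<Gamma>\<^sub>1 \<Gamma>\<^sub>2 - second_arens s s s mul \<Gamma>\<^sub>1 \<Gamma>\<^sub>2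
          \<in> biannihilator s (J_algebra s mul l r))"

definition act_module_regularly ::
    "('k::real_normed_field \<Rightarrow> 'a::banach \<Rightarrow> 'a) \<Rightarrow> ('k \<Rightarrow> 'b::banach \<Rightarrow> 'b) \<Rightarrow> ('k \<Rightarrow> 'm::banach \<Rightarrow> 'm)
      \<Rightarrow> ('a \<Rightarrow> 'm \<Rightarrow> 'm) \<Rightarrow> ('m \<Rightarrow> 'b \<Rightarrow> 'm)
      \<Rightarrow> ('a \<Rightarrow> 'r \<Rightarrow> 'a) \<Rightarrow> ('r \<Rightarrow> 'b \<Rightarrow> 'b) \<Rightarrow> ('r \<Rightarrow> 'm \<Rightarrow> 'm) \<Rightarrow> ('m \<Rightarrow> 'r \<Rightarrow> 'm) \<Rightarrow> bool" where
  "act_module_regularly sA sB sM aM bM rA lB lM rM \<longleftrightarrow>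
     (\<forall>\<Gamma>\<in>bidual_space sA. \<forall>\<Psi>\<in>bidual_space sB. \<forall>\<Phi>\<in>bidual_space sM.
        first_arens sA sM sM aM \<Gamma> \<Phi> - second_arens sA sM sM aM \<Gamma> \<Phi>
          \<in> biannihilator sM (J_module sM aM bM rA lB lM rM) \<and>
        first_arens sM sB sM bM \<Phi> \<Psi> - second_arens sM sB sM bM \<Phi> \<Psi>
          \<in> biannihilator sM (J_module sM aM bM rA lB lM rM))"


section \<open>Triangular matrices\<close>

text \<open>\<open>Tri a m b\<close> is the upper triangular matrix with diagonal entries \<open>a\<close>, \<open>b\<close> and upper right
  entry \<open>m\<close>.\<close>

datatype ('a, 'm, 'b) tri = Tri (entry11: 'a) (entry12: 'm) (entry22: 'b)

instantiation tri :: (real_normed_vector, real_normed_vector, real_normed_vector) real_normed_vector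
begin

definition "0 = Tri 0 0 0"
definition "s + t = Tri (entry11 s + entry11 t) (entry12 s + entry12 t) (entry22 s + entry22 t)"
definition "s - t = Tri (entry11 s - entry11 t) (entry12 s - entry12 t) (entry22 s - entry22 t)"
definition "- t = Tri (- entry11 t) (- entry12 t) (- entry22 t)"
definition "c *\<^sub>R t = Tri (c *\<^sub>R entry11 t) (c *\<^sub>R entry12 t) (c *\<^sub>R entry22 t)"
definition norm_tri_def: "norm t = norm (entry11 t) + norm (entry12 t) + norm (entry22 t)"
definition dist_tri_def: "dist s t = norm (s - t)" for s t :: "('a, 'b, 'c) tri"
definition sgn_tri_def: "sgn t = inverse (norm t) *\<^sub>R t" for t :: "('a, 'b, 'c) tri"
definition uniformity_tri_def:
  "uniformity = (INF e\<in>{0<..}. principal {(s, t :: ('a, 'b, 'c) tri). dist s t < e})"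
definition open_tri_def:
  "open U \<longleftrightarrow> (\<forall>s\<in>U. eventually (\<lambda>(s', t). s' = s \<longrightarrow> t \<in> U) uniformity)"
  for U :: "('a, 'b, 'c) tri set"

instance
proof
  fix s t u :: "('a, 'b, 'c) tri" and c d :: real
  note defs = zero_tri_def plus_tri_def minus_tri_def uminus_tri_def scaleR_tri_def norm_tri_def
  show "s + t + u = s + (t + u)" "s + t = t + s" "0 + t = t" "- t + t = 0" "s - t = s + - t"
    by (simp_all add: defs add_ac)
  show "c *\<^sub>R (s + t) = c *\<^sub>R s + c *\<^sub>R t" "(c + d) *\<^sub>R s = c *\<^sub>R s + d *\<^sub>R s"
    "c *\<^sub>R d *\<^sub>R s = (c * d) *\<^sub>R s" "1 *\<^sub>R s = s"
    by (simp_all add: defs scaleR_add_left scaleR_add_right)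
  show "dist s t = norm (s - t)" by (fact dist_tri_def)
  show "sgn t = inverse (norm t) *\<^sub>R t" by (fact sgn_tri_def)
  show "uniformity = (INF e\<in>{0<..}. principal {(s, t :: ('a, 'b, 'c) tri). dist s t < e})"
    by (fact uniformity_tri_def)
  show "open U \<longleftrightarrow> (\<forall>s\<in>U. eventually (\<lambda>(s', t). s' = s \<longrightarrow> t \<in> U) uniformity)"
    for U :: "('a, 'b, 'c) tri set" by (fact open_tri_def)
  show "norm t = 0 \<longleftrightarrow> t = 0"
    by (cases t) (auto simp: defs add_nonneg_eq_0_iff)
  show "norm (s + t) \<le> norm s + norm t"
    using norm_triangle_ineq[of "entry11 s" "entry11 t"] norm_triangle_ineq[of "entry12 s" "entry12 t"]
      norm_triangle_ineq[of "entry22 s" "entry22 t"] by (simp add: defs)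
  show "norm (c *\<^sub>R t) = \<bar>c\<bar> * norm t"
    by (simp add: defs algebra_simps)
qed

end

instance tri :: (banach, banach, banach) banach
proof
  fix X :: "nat \<Rightarrow> ('a, 'b, 'c) tri"
  assume X: "Cauchy X"
  have lim: "convergent (\<lambda>n. e (X n))"
    if "\<And>s t. dist (e s) (e t) \<le> dist s t" for e :: "('a, 'b, 'c) tri \<Rightarrow> 'd::banach"
  proof -
    have "Cauchy (\<lambda>n. e (X n))"
      unfolding Cauchy_def using X[unfolded Cauchy_def] that by (meson le_less_trans)
    then show ?thesis by (rule Cauchy_convergent)
  qed
  have "convergent (\<lambda>n. entry11 (X n))" "convergent (\<lambda>n. entry12 (X n))" "convergent (\<lambda>n. entry22 (X n))"
    using lim[of entry11] lim[of entry12] lim[of entry22]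
    by (simp_all add: dist_norm norm_tri_def minus_tri_def)
  then obtain a m b where *: "(\<lambda>n. entry11 (X n)) \<longlonglongrightarrow> a" "(\<lambda>n. entry12 (X n)) \<longlonglongrightarrow> m"
    "(\<lambda>n. entry22 (X n)) \<longlonglongrightarrow> b"
    by (auto simp: convergent_def)
  have "(\<lambda>n. norm (entry11 (X n) - a) + norm (entry12 (X n) - m) + norm (entry22 (X n) - b)) \<longlonglongrightarrow> 0 + 0 + 0"
    by (intro tendsto_add tendsto_norm_zero LIM_zero *)
  then have "X \<longlonglongrightarrow> Tri a m b"
    unfolding tendsto_dist_iff[of X] by (simp add: dist_norm norm_tri_def minus_tri_def)
  then show "convergent X" by (auto simp: convergent_def)
qed

definition tri_scale ::
    "('k \<Rightarrow> 'a \<Rightarrow> 'a) \<Rightarrow> ('k \<Rightarrow> 'm \<Rightarrow> 'm) \<Rightarrow> ('k \<Rightarrow> 'b \<Rightarrow> 'b) \<Rightarrow> 'k \<Rightarrow> ('a, 'm, 'b) tri \<Rightarrow> ('a, 'm, 'b) tri" where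
  "tri_scale sA sM sB c t = Tri (sA c (entry11 t)) (sM c (entry12 t)) (sB c (entry22 t))"

definition tri_mult ::
    "('a \<Rightarrow> 'a \<Rightarrow> 'a) \<Rightarrow> ('b \<Rightarrow> 'b \<Rightarrow> 'b) \<Rightarrow> ('a \<Rightarrow> 'm \<Rightarrow> 'm) \<Rightarrow> ('m \<Rightarrow> 'b \<Rightarrow> 'm::plus)
      \<Rightarrow> ('a, 'm, 'b) tri \<Rightarrow> ('a, 'm, 'b) tri \<Rightarrow> ('a, 'm, 'b) tri" where
  "tri_mult mA mB aM bM s t =
     Tri (mA (entry11 s) (entry11 t))
         (aM (entry11 s) (entry12 t) + bM (entry12 s) (entry22 t))
         (mB (entry22 s) (entry22 t))"

text \<open>With contractive actions of \<open>A\<close> and \<open>B\<close> on \<open>M\<close> the triangular matrices form a Banach algebra in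
  the strict sense; in general the multiplication is only bounded.\<close>

lemma tri_banach_algebra:
  assumes "banach_bimodule sA mA sB mB sM aM bM"
    and a_le: "\<And>a m. norm (aM a m) \<le> norm a * norm m"
    and b_le: "\<And>m b. norm (bM m b) \<le> norm m * norm b"
  shows "banach_algebra (tri_scale sA sM sB) (tri_mult mA mB aM bM)"
proof -
  interpret M: banach_bimodule sA mA sB mB sM aM bM by fact
  note defs = tri_scale_def tri_mult_def plus_tri_def scaleR_tri_def norm_tri_def
  have le: "norm (tri_mult mA mB aM bM s t) \<le> norm s * norm t" for s t
  proof -
    have "norm (tri_mult mA mB aM bM s t) \<le>
        norm (entry11 s) * norm (entry11 t) +
        (norm (entry11 s) * norm (entry12 t) + norm (entry12 s) * norm (entry22 t)) +
        norm (entry22 s) * norm (entry22 t)"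
      unfolding defs tri.sel
      by (intro add_mono M.left.alg.norm_mult_le M.right.alg.norm_mult_le
          order_trans[OF norm_triangle_ineq] a_le b_le)
    also have "\<dots> \<le> norm s * norm t"
      unfolding norm_tri_def by (simp add: algebra_simps)
    finally show ?thesis .
  qed
  note A = M.left.alg.scale_right_distrib M.left.alg.scale_left_distrib M.left.alg.scale_of_real
      M.left.alg.norm_scale M.left.alg.add_left M.left.alg.add_right M.left.alg.scaleR_left
      M.left.alg.scaleR_right M.left.alg.scale_left M.left.alg.scale_right M.left.alg.assoc
    and B = M.right.alg.scale_right_distrib M.right.alg.scale_left_distrib M.right.alg.scale_of_real
      M.right.alg.norm_scale M.right.alg.add_left M.right.alg.add_right M.right.alg.scaleR_left
      M.right.alg.scaleR_right M.right.alg.scale_left M.right.alg.scale_right M.right.alg.assoc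
    and M = M.left.sp.scale_right_distrib M.left.sp.scale_left_distrib M.left.sp.scale_of_real
      M.left.sp.norm_scale M.left.add_left M.left.add_right M.left.scaleR_left M.left.scaleR_right
      M.left.scale_left M.left.scale_right M.right.add_left M.right.add_right M.right.scaleR_left
      M.right.scaleR_right M.right.scale_left M.right.scale_right
      M.left.left_assoc M.right.right_assoc M.middle_assoc
  show ?thesis
  proof
    fix c d r and s t u
    let ?s = "tri_scale sA sM sB" and ?m = "tri_mult mA mB aM bM"
    show "?s c (s + t) = ?s c s + ?s c t" by (simp add: defs A B M)
    show "?s (c + d) s = ?s c s + ?s d s" by (simp add: defs A B M)
    show "?s c (?s d s) = ?s (c * d) s" by (simp add: defs)
    show "?s 1 s = s" by (simp add: defs)
    show "?s (of_real r) s = r *\<^sub>R s" by (simp add: defs A B M)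
    show "norm (?s c s) = norm c * norm s" by (simp add: defs A B M distrib_left)
    show "?m (s + t) u = ?m s u + ?m t u" by (simp add: defs A B M add_ac)
    show "?m s (t + u) = ?m s t + ?m s u" by (simp add: defs A B M add_ac)
    show "?m (r *\<^sub>R s) t = r *\<^sub>R ?m s t" by (simp add: defs A B M scaleR_add_right)
    show "?m s (r *\<^sub>R t) = r *\<^sub>R ?m s t" by (simp add: defs A B M scaleR_add_right)
    show "\<exists>K. \<forall>s t. norm (?m s t) \<le> norm s * norm t * K"
      using le by (intro exI[of _ 1]) simp
    show "?m (?s c s) t = ?s c (?m s t)" by (simp add: defs A B M)
    show "?m s (?s c t) = ?s c (?m s t)" by (simp add: defs A B M)
    show "?m (?m s t) u = ?m s (?m t u)" by (simp add: defs A B M add_ac)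
    show "norm (?m s t) \<le> norm s * norm t" by (rule le)
  qed
qed

text \<open>\<open>Diag \<alpha>\<close> is the diagonal matrix with both diagonal entries \<open>\<alpha>\<close>.\<close>

datatype 'r diag = Diag (diag_entry: 'r)

definition tri_left_act ::
    "('r \<Rightarrow> 'a \<Rightarrow> 'a) \<Rightarrow> ('r \<Rightarrow> 'm \<Rightarrow> 'm) \<Rightarrow> ('r \<Rightarrow> 'b \<Rightarrow> 'b)
      \<Rightarrow> 'r diag \<Rightarrow> ('a, 'm, 'b) tri \<Rightarrow> ('a, 'm, 'b) tri" where
  "tri_left_act lA lM lB d t =
     Tri (lA (diag_entry d) (entry11 t)) (lM (diag_entry d) (entry12 t)) (lB (diag_entry d) (entry22 t))"

definition tri_right_act ::
    "('a \<Rightarrow> 'r \<Rightarrow> 'a) \<Rightarrow> ('m \<Rightarrow> 'r \<Rightarrow> 'm) \<Rightarrow> ('b \<Rightarrow> 'r \<Rightarrow> 'b)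
      \<Rightarrow> ('a, 'm, 'b) tri \<Rightarrow> 'r diag \<Rightarrow> ('a, 'm, 'b) tri" where
  "tri_right_act rA rM rB t d =
     Tri (rA (entry11 t) (diag_entry d)) (rM (entry12 t) (diag_entry d)) (rB (entry22 t) (diag_entry d))"

end

theory Submission
  imports Defs
begin

text \<open>The two Arens products evaluate a functional \<open>h\<close> at \<open>\<Gamma> (\<lambda>x. \<Phi> (\<lambda>y. h (p x y)))\<close> and
  \<open>\<Phi> (\<lambda>y. \<Gamma> (\<lambda>x. h (p x y)))\<close>, so every regularity condition says that \<open>\<Gamma>\<close> and \<open>\<Phi>\<close> can be
  interchanged on the forms \<open>h (p x y)\<close> with \<open>h\<close> in the annihilator of the respective \<open>J\<close>. This
  property is additive in the form and natural in the spaces. The compatibility of the actions makes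
  \<open>J\<^sub>T\<close> the set of triangular matrices with entries in \<open>J\<^sub>A\<close>, \<open>J\<^sub>M\<close>, \<open>J\<^sub>B\<close>: the point is that \<open>J\<^sub>M\<close> is
  invariant under \<open>A\<close> and \<open>B\<close> and contains \<open>J\<^sub>A M\<close> and \<open>M J\<^sub>B\<close>. Hence the condition for \<open>T\<close> splits
  along the four products that occur in the multiplication of \<open>T\<close>.\<close>

section \<open>Bilinear forms, second adjoints and the interchange of functionals\<close>

definition bounded_linear_over ::
    "('k \<Rightarrow> 'x::real_normed_vector \<Rightarrow> 'x) \<Rightarrow> ('k \<Rightarrow> 'y::real_normed_vector \<Rightarrow> 'y) \<Rightarrow> ('x \<Rightarrow> 'y) \<Rightarrow> bool" where
  "bounded_linear_over sX sY \<phi> \<longleftrightarrow> bounded_linear \<phi> \<and> (\<forall>c x. \<phi> (sX c x) = sY c (\<phi> x))"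

text \<open>\<open>bounded_bilinear\<close>, like \<open>bounded_linear\<close> above, knows real
  scalars only, so homogeneity over the field \<open>'k\<close> is a separate conjunct.\<close>

definition bounded_bilinear_form ::
    "('k::real_normed_field \<Rightarrow> 'x::real_normed_vector \<Rightarrow> 'x) \<Rightarrow> ('k \<Rightarrow> 'y::real_normed_vector \<Rightarrow> 'y)
      \<Rightarrow> ('x \<Rightarrow> 'y \<Rightarrow> 'k) \<Rightarrow> bool" where
  "bounded_bilinear_form sX sY \<beta> \<longleftrightarrow> bounded_bilinear \<beta> \<and>
     (\<forall>c x y. \<beta> (sX c x) y = c * \<beta> x y) \<and> (\<forall>c x y. \<beta> x (sY c y) = c * \<beta> x y)"

text \<open>The second adjoint of \<open>\<phi>\<close>. The value 0 off the dual space is the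
  default that \<open>bidual_space\<close> prescribes.\<close>

definition bidual_map ::
    "('k::real_normed_field \<Rightarrow> 'y::banach \<Rightarrow> 'y) \<Rightarrow> ('x::banach \<Rightarrow> 'y) \<Rightarrow> (('x \<Rightarrow> 'k) \<Rightarrow> 'k) \<Rightarrow> ('y \<Rightarrow> 'k) \<Rightarrow> 'k" where
  "bidual_map sY \<phi> \<Gamma> f = (if f \<in> dual_space sY then \<Gamma> (\<lambda>x. f (\<phi> x)) else 0)"

text \<open>Only a scalar form enters, with no product and no target space, so that the condition
  can be added up and pulled back along linear maps.\<close>

definition limits_commute ::
    "(('x \<Rightarrow> 'k) \<Rightarrow> 'k) \<Rightarrow> (('y \<Rightarrow> 'k) \<Rightarrow> 'k) \<Rightarrow> ('x \<Rightarrow> 'y \<Rightarrow> 'k) \<Rightarrow> bool" where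
  "limits_commute \<Gamma> \<Phi> \<beta> \<longleftrightarrow> \<Gamma> (\<lambda>x. \<Phi> (\<lambda>y. \<beta> x y)) = \<Phi> (\<lambda>y. \<Gamma> (\<lambda>x. \<beta> x y))"

lemma dual_spaceD:
  assumes "f \<in> dual_space s"
  shows "bounded_linear f" "f (s c x) = c * f x"
  using assms by (auto simp: dual_space_def)

lemma dual_space_compose:
  assumes "f \<in> dual_space sY" "bounded_linear_over sX sY \<phi>"
  shows "(\<lambda>x. f (\<phi> x)) \<in> dual_space sX"
  using assms by (auto simp: dual_space_def bounded_linear_over_def intro: bounded_linear_compose)

lemma bidual_add:
  assumes "\<Gamma> \<in> bidual_space s" "f \<in> dual_space s" "g \<in> dual_space s"
  shows "\<Gamma> (\<lambda>x. f x + g x) = \<Gamma> f + \<Gamma> g"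
  using assms by (simp add: bidual_space_def)

lemma bidual_mult:
  assumes "\<Gamma> \<in> bidual_space s" "f \<in> dual_space s"
  shows "\<Gamma> (\<lambda>x. c * f x) = c * \<Gamma> f"
  using assms by (simp add: bidual_space_def)

lemma bidual_diff:
  assumes "\<Gamma> \<in> bidual_space s" "\<Gamma>' \<in> bidual_space s"
  shows "\<Gamma> - \<Gamma>' \<in> bidual_space s"
proof -
  obtain K K' where K: "\<forall>f\<in>dual_space s. norm (\<Gamma> f) \<le> K * onorm f"
    "\<forall>f\<in>dual_space s. norm (\<Gamma>' f) \<le> K' * onorm f"
    using assms by (auto simp: bidual_space_def)
  have "norm (\<Gamma> f - \<Gamma>' f) \<le> (K + K') * onorm f" if "f \<in> dual_space s" for f
  proof -
    have "norm (\<Gamma> f - \<Gamma>' f) \<le> norm (\<Gamma> f) + norm (\<Gamma>' f)" by (rule norm_triangle_ineq4)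
    also have "\<dots> \<le> K * onorm f + K' * onorm f" using K that by (intro add_mono) auto
    finally show ?thesis by (simp add: distrib_right)
  qed
  then have "\<exists>K. \<forall>f\<in>dual_space s. norm ((\<Gamma> - \<Gamma>') f) \<le> K * onorm f" by auto
  then show ?thesis
    using assms unfolding bidual_space_def by (simp add: algebra_simps)
qed

lemma bidual_map_in_bidual:
  assumes \<Gamma>: "\<Gamma> \<in> bidual_space sX" and \<phi>: "bounded_linear_over sX sY \<phi>"
  shows "bidual_map sY \<phi> \<Gamma> \<in> bidual_space sY"
proof -
  obtain K where K: "K \<ge> 0" "\<forall>f\<in>dual_space sX. norm (\<Gamma> f) \<le> K * onorm f"
    using bidual_bound[OF \<Gamma>] by blast
  have bl: "bounded_linear \<phi>" using \<phi> by (simp add: bounded_linear_over_def)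
  note comp = dual_space_compose[OF _ \<phi>]
  have "norm (bidual_map sY \<phi> \<Gamma> f) \<le> (K * onorm \<phi>) * onorm f" if f: "f \<in> dual_space sY" for f
  proof -
    have "norm (bidual_map sY \<phi> \<Gamma> f) \<le> K * onorm (f \<circ> \<phi>)"
      using K(2) comp[OF f] f by (simp add: bidual_map_def comp_def)
    also have "\<dots> \<le> K * (onorm f * onorm \<phi>)"
      using K(1) onorm_compose[OF dual_spaceD(1)[OF f] bl] by (rule mult_left_mono[rotated])
    finally show ?thesis by (simp add: mult_ac)
  qed
  then show ?thesis
    unfolding bidual_space_def
    by (auto simp: bidual_map_def dual_space_add dual_space_mult
        bidual_add[OF \<Gamma> comp comp] bidual_mult[OF \<Gamma> comp])
qed

lemma bounded_bilinear_form_flip: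
  "bounded_bilinear_form sX sY \<beta> \<Longrightarrow> bounded_bilinear_form sY sX (\<lambda>y x. \<beta> x y)"
  by (auto simp: bounded_bilinear_form_def bounded_bilinear.flip)

lemma bounded_bilinear_form_right:
  "bounded_bilinear_form sX sY \<beta> \<Longrightarrow> \<beta> x \<in> dual_space sY"
  by (auto simp: bounded_bilinear_form_def dual_space_def bounded_bilinear.bounded_linear_right)

lemma bounded_bilinear_form_left:
  "bounded_bilinear_form sX sY \<beta> \<Longrightarrow> (\<lambda>x. \<beta> x y) \<in> dual_space sX"
  using bounded_bilinear_form_right[OF bounded_bilinear_form_flip] .

lemma bounded_bilinear_form_add:
  assumes "bounded_bilinear_form sX sY \<beta>" "bounded_bilinear_form sX sY \<gamma>"
  shows "bounded_bilinear_form sX sY (\<lambda>x y. \<beta> x y + \<gamma> x y)"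
proof -
  interpret \<beta>: bounded_bilinear \<beta> using assms by (simp add: bounded_bilinear_form_def)
  interpret \<gamma>: bounded_bilinear \<gamma> using assms by (simp add: bounded_bilinear_form_def)
  obtain K L where K: "\<And>x y. norm (\<beta> x y) \<le> norm x * norm y * K"
    and L: "\<And>x y. norm (\<gamma> x y) \<le> norm x * norm y * L"
    using \<beta>.bounded \<gamma>.bounded by blast
  have "norm (\<beta> x y + \<gamma> x y) \<le> norm x * norm y * (K + L)" for x y
    using norm_triangle_le[OF add_mono[OF K L]] by (simp add: distrib_left)
  then have "bounded_bilinear (\<lambda>x y. \<beta> x y + \<gamma> x y)"
    by unfold_locales
      (auto simp: \<beta>.add_left \<beta>.add_right \<gamma>.add_left \<gamma>.add_right \<beta>.scaleR_left \<beta>.scaleR_right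
        \<gamma>.scaleR_left \<gamma>.scaleR_right scaleR_add_right)
  then show ?thesis
    using assms by (auto simp: bounded_bilinear_form_def distrib_left)
qed

lemma bounded_bilinear_form_compose:
  assumes p: "bounded_bilinear_over sX sY sZ p" and h: "h \<in> dual_space sZ"
    and \<phi>: "bounded_linear_over sX' sX \<phi>" and \<psi>: "bounded_linear_over sY' sY \<psi>"
  shows "bounded_bilinear_form sX' sY' (\<lambda>x y. h (p (\<phi> x) (\<psi> y)))"
proof -
  interpret p: bounded_bilinear_over sX sY sZ p by fact
  have "bounded_bilinear (\<lambda>x y. p (\<phi> x) (\<psi> y))"
    using \<phi> \<psi> p.comp by (auto simp: bounded_linear_over_def)
  then interpret q: bounded_bilinear "\<lambda>x y. p (\<phi> x) (\<psi> y)" .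
  interpret h: bounded_linear h using h by (rule dual_spaceD)
  obtain K L where K: "\<And>x y. norm (p (\<phi> x) (\<psi> y)) \<le> norm x * norm y * K"
    and L: "L \<ge> 0" "\<And>z. norm (h z) \<le> norm z * L"
    using q.bounded h.nonneg_bounded by blast
  have "norm (h (p (\<phi> x) (\<psi> y))) \<le> norm x * norm y * (K * L)" for x y
    using order_trans[OF L(2) mult_right_mono[OF K L(1)]] by (simp add: mult.assoc)
  then have "bounded_bilinear (\<lambda>x y. h (p (\<phi> x) (\<psi> y)))"
    by unfold_locales
      (auto simp: q.add_left q.add_right q.scaleR_left q.scaleR_right h.add h.scaleR)
  then show ?thesis
    using \<phi> \<psi> by (simp add: bounded_bilinear_form_def bounded_linear_over_def p.scale_left
        p.scale_right dual_spaceD(2)[OF h])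
qed

lemma bounded_linear_over_id: "bounded_linear_over s s (\<lambda>x. x)"
  by (simp add: bounded_linear_over_def)

text \<open>The bound on \<open>\<beta>\<close> gives
  \<open>onorm (\<beta> x) \<le> norm x * L\<close>, and \<open>\<Phi>\<close> is bounded on the
  dual. Since elements of the bidual carry information only on the dual space, this is what makes
  iterated evaluations meaningful.\<close>

lemma bidual_slice_in_dual:
  assumes \<beta>: "bounded_bilinear_form sX sY \<beta>" and \<Phi>: "\<Phi> \<in> bidual_space sY"
  shows "(\<lambda>x. \<Phi> (\<beta> x)) \<in> dual_space sX"
proof -
  interpret \<beta>: bounded_bilinear \<beta> using \<beta> by (simp add: bounded_bilinear_form_def)
  note dual = bounded_bilinear_form_right[OF \<beta>]
  obtain K where K: "K \<ge> 0" "\<forall>f\<in>dual_space sY. norm (\<Phi> f) \<le> K * onorm f"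
    using bidual_bound[OF \<Phi>] by blast
  obtain L where L: "L \<ge> 0" "\<And>x y. norm (\<beta> x y) \<le> norm x * norm y * L"
    using \<beta>.nonneg_bounded by blast
  have "bounded_linear (\<lambda>x. \<Phi> (\<beta> x))"
  proof (rule bounded_linear_intro)
    fix x y r
    \<comment> \<open>\<open>\<Phi>\<close> is additive and homogeneous on functionals, so linearity
      in \<open>x\<close> is first turned into identities between functionals of
      \<open>z\<close>.\<close>
    have "\<beta> (x + y) = (\<lambda>z. \<beta> x z + \<beta> y z)" "\<beta> (r *\<^sub>R x) = (\<lambda>z. of_real r * \<beta> x z)"
      by (auto simp: \<beta>.add_left \<beta>.scaleR_left scaleR_conv_of_real)
    then show "\<Phi> (\<beta> (x + y)) = \<Phi> (\<beta> x) + \<Phi> (\<beta> y)" "\<Phi> (\<beta> (r *\<^sub>R x)) = r *\<^sub>R \<Phi> (\<beta> x)"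
      by (simp_all add: bidual_add[OF \<Phi> dual dual] bidual_mult[OF \<Phi> dual] scaleR_conv_of_real)
    have "onorm (\<beta> x) \<le> norm x * L"
      using L by (intro onorm_bound) (auto simp: mult_ac)
    then show "norm (\<Phi> (\<beta> x)) \<le> norm x * (K * L)"
      using K dual[of x] mult_left_mono[of "onorm (\<beta> x)" "norm x * L" K] by (force simp: mult_ac)
  qed
  moreover have "\<Phi> (\<beta> (sX c x)) = c * \<Phi> (\<beta> x)" for c x
  proof -
    have "\<beta> (sX c x) = (\<lambda>z. c * \<beta> x z)" using \<beta> by (auto simp: bounded_bilinear_form_def)
    then show ?thesis by (simp add: bidual_mult[OF \<Phi> dual])
  qed
  ultimately show ?thesis by (simp add: dual_space_def)
qed

text \<open>Both orders of evaluation are additive in the form: the inner functional on slices of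
  \<open>\<beta>\<close> and \<open>\<gamma>\<close>, the outer one on the functionals supplied by
  \<open>bidual_slice_in_dual\<close>.\<close>

lemma limits_commute_add:
  assumes \<Gamma>: "\<Gamma> \<in> bidual_space sX" and \<Phi>: "\<Phi> \<in> bidual_space sY"
    and \<beta>: "bounded_bilinear_form sX sY \<beta>" and \<gamma>: "bounded_bilinear_form sX sY \<gamma>"
    and "limits_commute \<Gamma> \<Phi> \<beta>" "limits_commute \<Gamma> \<Phi> \<gamma>"
  shows "limits_commute \<Gamma> \<Phi> (\<lambda>x y. \<beta> x y + \<gamma> x y)"
proof -
  note right = bounded_bilinear_form_right and left = bounded_bilinear_form_left
    and flip = bounded_bilinear_form_flip
  show ?thesis
    using assms(5,6) unfolding limits_commute_def
    by (simp add: bidual_add[OF \<Phi> right[OF \<beta>] right[OF \<gamma>]] bidual_add[OF \<Gamma> left[OF \<beta>] left[OF \<gamma>]]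
      bidual_add[OF \<Gamma> bidual_slice_in_dual[OF \<beta> \<Phi>] bidual_slice_in_dual[OF \<gamma> \<Phi>]]
      bidual_add[OF \<Phi> bidual_slice_in_dual[OF flip[OF \<beta>] \<Gamma>] bidual_slice_in_dual[OF flip[OF \<gamma>] \<Gamma>]])
qed

text \<open>A second adjoint evaluates by composing with the map as long as its argument lies in the
  dual, and every slice and inner evaluation of \<open>\<beta>\<close> does. One half of the theorem
  applies this to the injections into \<open>T\<close>, the other to the entry maps.\<close>

lemma limits_commute_bidual_map:
  assumes \<Gamma>: "\<Gamma> \<in> bidual_space sX" and \<Phi>: "\<Phi> \<in> bidual_space sY"
    and \<phi>: "bounded_linear_over sX sX' \<phi>" and \<psi>: "bounded_linear_over sY sY' \<psi>"
    and \<beta>: "bounded_bilinear_form sX' sY' \<beta>"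
  shows "limits_commute (bidual_map sX' \<phi> \<Gamma>) (bidual_map sY' \<psi> \<Phi>) \<beta> \<longleftrightarrow>
    limits_commute \<Gamma> \<Phi> (\<lambda>x y. \<beta> (\<phi> x) (\<psi> y))"
proof -
  note \<Gamma>' = bidual_map_in_bidual[OF \<Gamma> \<phi>] and \<Phi>' = bidual_map_in_bidual[OF \<Phi> \<psi>]
  have inner: "bidual_map sY' \<psi> \<Phi> (\<beta> x) = \<Phi> (\<lambda>y. \<beta> x (\<psi> y))" for x
    by (simp add: bidual_map_def bounded_bilinear_form_right[OF \<beta>])
  have inner': "bidual_map sX' \<phi> \<Gamma> (\<lambda>x. \<beta> x y) = \<Gamma> (\<lambda>x. \<beta> (\<phi> x) y)" for y
    by (simp add: bidual_map_def bounded_bilinear_form_left[OF \<beta>])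
  have "bidual_map sX' \<phi> \<Gamma> (\<lambda>x. bidual_map sY' \<psi> \<Phi> (\<beta> x)) = \<Gamma> (\<lambda>x. \<Phi> (\<lambda>y. \<beta> (\<phi> x) (\<psi> y)))"
    using bidual_slice_in_dual[OF \<beta> \<Phi>'] by (simp add: bidual_map_def[of sX'] inner)
  moreover have "bidual_map sY' \<psi> \<Phi> (\<lambda>y. bidual_map sX' \<phi> \<Gamma> (\<lambda>x. \<beta> x y)) =
      \<Phi> (\<lambda>y. \<Gamma> (\<lambda>x. \<beta> (\<phi> x) (\<psi> y)))"
    using bidual_slice_in_dual[OF bounded_bilinear_form_flip[OF \<beta>] \<Gamma>']
    by (simp add: bidual_map_def[of sY'] inner')
  ultimately show ?thesis by (simp add: limits_commute_def)
qed

section \<open>Arens products as iterated evaluations\<close>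

lemma first_arens_eq:
  assumes sX: "banach_space sX" and sY: "banach_space sY" and p: "bounded_bilinear_over sX sY sZ p"
    and \<Gamma>: "\<Gamma> \<in> bidual_space sX" and \<Phi>: "\<Phi> \<in> bidual_space sY"
  shows "first_arens sX sY sZ p \<Gamma> \<Phi> \<in> bidual_space sZ"
    and "h \<in> dual_space sZ \<Longrightarrow> first_arens sX sY sZ p \<Gamma> \<Phi> h = \<Gamma> (\<lambda>x. \<Phi> (\<lambda>y. h (p x y)))"
proof -
  let ?\<Lambda> = "first_arens sX sY sZ p \<Gamma> \<Phi>"
  have \<Lambda>: "?\<Lambda> \<in> bidual_space sZ \<and>
      (\<forall>F G. weak_star_lim sX F \<Gamma> \<longrightarrow> weak_star_lim sY G \<Phi> \<longrightarrow> iterated_weak_star_lim sZ p F G ?\<Lambda>)"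
    unfolding first_arens_def by (rule theI'[OF first_arens_ex1[OF assms]])
  then show "?\<Lambda> \<in> bidual_space sZ" ..
  assume h: "h \<in> dual_space sZ"
  note form = bounded_bilinear_form_compose[OF p h bounded_linear_over_id bounded_linear_over_id]
  \<comment> \<open>One pair of filters converging to \<open>\<Gamma>\<close> and
    \<open>\<Phi>\<close> already determines the value.\<close>
  obtain F G where F: "weak_star_lim sX F \<Gamma>" and G: "weak_star_lim sY G \<Phi>"
    using weak_star_lim_exists[OF sX \<Gamma>] weak_star_lim_exists[OF sY \<Phi>] by blast
  then obtain L where L: "\<And>x. ((\<lambda>y. h (p x y)) \<longlongrightarrow> L x) G" "(L \<longlongrightarrow> ?\<Lambda> h) F"
    using \<Lambda> h unfolding iterated_weak_star_lim_def by blast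
  \<comment> \<open>The slice lies in the dual, so it converges along \<open>G\<close> to its value
    under \<open>\<Phi>\<close> as well; \<open>G\<close> is proper, hence limits are unique. The
    outer limit along \<open>F\<close> is identified in the same way.\<close>
  have "L x = \<Phi> (\<lambda>y. h (p x y))" for x
    using G bounded_bilinear_form_right[OF form] unfolding weak_star_lim_def
    by (intro tendsto_unique[OF _ L(1)]) auto
  then have "L = (\<lambda>x. \<Phi> (\<lambda>y. h (p x y)))" ..
  then show "?\<Lambda> h = \<Gamma> (\<lambda>x. \<Phi> (\<lambda>y. h (p x y)))"
    using F L(2) bidual_slice_in_dual[OF form \<Phi>] unfolding weak_star_lim_def
    by (intro tendsto_unique[OF _ L(2)]) auto
qed

text \<open>With \<open>second_arens_flip\<close> the second product is a first product of the
  flipped map, so \<open>first_arens_eq\<close> covers both.\<close>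

lemma bounded_bilinear_over_flip:
  assumes "bounded_bilinear_over sX sY sZ p"
  shows "bounded_bilinear_over sY sX sZ (\<lambda>y x. p x y)"
proof -
  interpret bounded_bilinear_over sX sY sZ p by fact
  show ?thesis
    by (intro bounded_bilinear_over.intro bounded_bilinear_over_axioms.intro flip scale_left scale_right)
qed

text \<open>Both products lie in the bidual, so only vanishing on the annihilator is at stake; by
  \<open>first_arens_eq\<close> the values at \<open>h\<close> are the two iterated
  evaluations.\<close>

lemma arens_diff_in_biannihilator_iff:
  assumes sX: "banach_space sX" and sY: "banach_space sY" and p: "bounded_bilinear_over sX sY sZ p"
    and \<Gamma>: "\<Gamma> \<in> bidual_space sX" and \<Phi>: "\<Phi> \<in> bidual_space sY"
  shows "first_arens sX sY sZ p \<Gamma> \<Phi> - second_arens sX sY sZ p \<Gamma> \<Phi> \<in> biannihilator sZ J \<longleftrightarrow>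
    (\<forall>h\<in>annihilator sZ J. limits_commute \<Gamma> \<Phi> (\<lambda>x y. h (p x y)))"
  using first_arens_eq[OF sX sY p \<Gamma> \<Phi>] first_arens_eq[OF sY sX bounded_bilinear_over_flip[OF p] \<Phi> \<Gamma>]
  by (auto simp: biannihilator_def second_arens_flip bidual_diff limits_commute_def annihilator_def)

lemma module_arens_regular_iff:
  assumes "banach_space s" "bounded_bilinear_over s s s mul"
  shows "module_arens_regular s mul l r \<longleftrightarrow>
    (\<forall>\<Gamma>\<in>bidual_space s. \<forall>\<Phi>\<in>bidual_space s. \<forall>h\<in>annihilator s (J_algebra s mul l r).
      limits_commute \<Gamma> \<Phi> (\<lambda>x y. h (mul x y)))"
  using arens_diff_in_biannihilator_iff[OF assms(1,1,2)] by (simp add: module_arens_regular_def)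

lemma zero_in_bidual: "(\<lambda>f. 0) \<in> bidual_space s"
  by (auto simp: bidual_space_def intro: exI[of _ 0])

text \<open>The two conditions can be separated because neither bidual is empty.\<close>

lemma act_module_regularly_iff:
  assumes "banach_space sA" "banach_space sB" "banach_space sM"
    "bounded_bilinear_over sA sM sM aM" "bounded_bilinear_over sM sB sM bM"
  shows "act_module_regularly sA sB sM aM bM rA lB lM rM \<longleftrightarrow>
    (\<forall>\<Phi>\<in>bidual_space sM. \<forall>h\<in>annihilator sM (J_module sM aM bM rA lB lM rM).
      (\<forall>\<Gamma>\<in>bidual_space sA. limits_commute \<Gamma> \<Phi> (\<lambda>a m. h (aM a m))) \<and>
      (\<forall>\<Psi>\<in>bidual_space sB. limits_commute \<Phi> \<Psi> (\<lambda>m b. h (bM m b))))"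
  using arens_diff_in_biannihilator_iff[OF assms(1,3,4)] arens_diff_in_biannihilator_iff[OF assms(3,2,5)]
    zero_in_bidual[of sA] zero_in_bidual[of sB]
  by (auto simp: act_module_regularly_def)

section \<open>Closed subspaces, generated ideals and annihilators\<close>

text \<open>The predicate whose hull defines \<open>J_module\<close>, and the linear part of
  \<open>closed_ideal\<close>.\<close>

definition closed_subspace :: "('k::real_normed_field \<Rightarrow> 'x::banach \<Rightarrow> 'x) \<Rightarrow> 'x set \<Rightarrow> bool" where
  "closed_subspace s S \<longleftrightarrow> closed S \<and> module.subspace s S"

text \<open>Each inclusion of a \<open>J\<close> below places it in a preimage, or an intersection
  of preimages, of some \<open>J\<close> and appeals to minimality of the hull.\<close>

lemma closed_subspace_vimage:
  assumes "banach_space sX" "banach_space sY" "bounded_linear_over sX sY \<phi>" "closed_subspace sY S"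
  shows "closed_subspace sX (\<phi> -` S)"
proof -
  interpret X: banach_space sX by fact
  interpret Y: banach_space sY by fact
  interpret \<phi>: bounded_linear \<phi> using assms(3) by (simp add: bounded_linear_over_def)
  have "closed (\<phi> -` S)"
    using assms(4) by (intro continuous_closed_vimage) (auto simp: closed_subspace_def \<phi>.isCont)
  then show ?thesis
    using assms(3,4) by (auto simp: closed_subspace_def X.subspace_def Y.subspace_def \<phi>.zero \<phi>.add
        bounded_linear_over_def)
qed

lemma closed_subspace_Inter:
  assumes "banach_space s" "\<forall>S\<in>\<S>. closed_subspace s S"
  shows "closed_subspace s (\<Inter>\<S>)"
proof -
  interpret banach_space s by fact
  show ?thesis using assms(2) by (auto simp: closed_subspace_def intro: subspace_Inter)
qed

lemma closed_ideal_iff: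
  "closed_ideal s mul I \<longleftrightarrow> closed_subspace s I \<and> (\<forall>x\<in>I. \<forall>a. mul a x \<in> I \<and> mul x a \<in> I)"
  by (auto simp: closed_ideal_def closed_subspace_def)

lemma closed_ideal_J_algebra:
  assumes "banach_space s"
  shows "closed_ideal s mul (J_algebra s mul l r)"
  unfolding J_algebra_def
proof (rule hull_in)
  fix \<I> assume "Ball \<I> (closed_ideal s mul)"
  then show "closed_ideal s mul (\<Inter>\<I>)"
    using closed_subspace_Inter[OF assms, of \<I>] by (auto simp: closed_ideal_iff)
qed

lemma closed_subspace_J_module:
  assumes "banach_space sM"
  shows "closed_subspace sM (J_module sM aM bM rA lB lM rM)"
  unfolding J_module_def closed_subspace_def[symmetric]
  by (rule hull_in) (rule closed_subspace_Inter[OF assms])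

lemma J_algebra_generator: "mul (r a \<alpha>) b - mul a (l \<alpha> b) \<in> J_algebra s mul l r"
  unfolding J_algebra_def by (rule hull_inc) blast

lemma J_algebra_minimal:
  assumes "closed_ideal s mul I" "\<And>a b \<alpha>. mul (r a \<alpha>) b - mul a (l \<alpha> b) \<in> I"
  shows "J_algebra s mul l r \<subseteq> I"
  unfolding J_algebra_def using assms by (intro hull_minimal) auto

lemma J_module_generator:
  "aM a (lM \<alpha> m) - aM (rA a \<alpha>) m \<in> J_module sM aM bM rA lB lM rM"
  "bM m (lB \<alpha> b) - bM (rM m \<alpha>) b \<in> J_module sM aM bM rA lB lM rM"
  unfolding J_module_def by (rule hull_inc; blast)+

lemma J_module_minimal:
  assumes "closed_subspace sM S" "\<And>a m \<alpha>. aM a (lM \<alpha> m) - aM (rA a \<alpha>) m \<in> S"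
    "\<And>m b \<alpha>. bM m (lB \<alpha> b) - bM (rM m \<alpha>) b \<in> S"
  shows "J_module sM aM bM rA lB lM rM \<subseteq> S"
  unfolding J_module_def closed_subspace_def[symmetric] using assms by (intro hull_minimal) auto

lemma annihilator_in_dual: "h \<in> annihilator s J \<Longrightarrow> h \<in> dual_space s"
  by (simp add: annihilator_def)

text \<open>Moves test functionals between \<open>T\<close> and its corners: an inclusion of the
  \<open>J\<close> sets in one direction pulls annihilators back in the other.\<close>

lemma annihilator_compose:
  assumes "h \<in> annihilator sY J" "bounded_linear_over sX sY \<phi>" "\<phi> ` I \<subseteq> J"
  shows "(\<lambda>x. h (\<phi> x)) \<in> annihilator sX I"
  using assms dual_space_compose[OF _ assms(2), of h] by (auto simp: annihilator_def)

lemma (in bounded_bilinear_over) bounded_linear_over_left: "bounded_linear_over sX sZ (\<lambda>x. f x y)"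
  by (simp add: bounded_linear_over_def bounded_linear_left scale_left)

lemma (in bounded_bilinear_over) bounded_linear_over_right: "bounded_linear_over sY sZ (f x)"
  by (simp add: bounded_linear_over_def bounded_linear_right scale_right)

section \<open>The triangular matrices as a Banach space with bounded multiplication\<close>

context triangular_setting
begin

abbreviation "sT \<equiv> tri_scale sA sM sB"
abbreviation "mT \<equiv> tri_mult mA mB aM bM"
abbreviation "JA \<equiv> J_algebra sA mA lA rA"
abbreviation "JB \<equiv> J_algebra sB mB lB rB"
abbreviation "JM \<equiv> J_module sM aM bM rA lB lM rM"
abbreviation "JT \<equiv> J_algebra sT mT (tri_left_act lA lM lB) (tri_right_act rA rM rB)"
abbreviation "inj11 a \<equiv> Tri a 0 0 :: ('a, 'm, 'b) tri"
abbreviation "inj12 m \<equiv> Tri 0 m 0 :: ('a, 'm, 'b) tri"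
abbreviation "inj22 b \<equiv> Tri 0 0 b :: ('a, 'm, 'b) tri"

lemmas tri_defs = tri_scale_def tri_mult_def plus_tri_def scaleR_tri_def norm_tri_def zero_tri_def
  minus_tri_def tri_left_act_def tri_right_act_def

lemmas banach_spaces = A.A.banach_space_axioms B.A.banach_space_axioms M.left.sp.banach_space_axioms

lemmas bilinear_overs = A.A.bounded_bilinear_over_axioms B.A.bounded_bilinear_over_axioms
  M.left.bounded_bilinear_over_axioms M.right.bounded_bilinear_over_axioms

lemma banach_space_tri: "banach_space sT"
proof
  fix c d r and s t :: "('a, 'm, 'b) tri"
  note A = A.A.scale_right_distrib A.A.scale_left_distrib A.A.scale_of_real A.A.norm_scale
    and B = B.A.scale_right_distrib B.A.scale_left_distrib B.A.scale_of_real B.A.norm_scale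
    and M = M.left.sp.scale_right_distrib M.left.sp.scale_left_distrib M.left.sp.scale_of_real
      M.left.sp.norm_scale
  show "sT c (s + t) = sT c s + sT c t" "sT (c + d) s = sT c s + sT d s"
    "sT c (sT d s) = sT (c * d) s" "sT 1 s = s" "sT (of_real r) s = r *\<^sub>R s"
    "norm (sT c s) = norm c * norm s"
    by (simp_all add: tri_defs A B M distrib_left)
qed

lemma bounded_linear_over_tri:
  shows inj11: "bounded_linear_over sA sT inj11"
    and inj12: "bounded_linear_over sM sT inj12"
    and inj22: "bounded_linear_over sB sT inj22"
    and entry11: "bounded_linear_over sT sA entry11"
    and entry12: "bounded_linear_over sT sM entry12"
    and entry22: "bounded_linear_over sT sB entry22"
  unfolding bounded_linear_over_def
  by (auto intro!: bounded_linear_intro[of _ 1] simp: tri_defs)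

text \<open>\<open>tri_banach_algebra\<close> asks for contractive actions on \<open>M\<close>,
  while here they are only bounded. A bounded bilinear multiplication is what
  \<open>module_arens_regular_iff\<close> requires.\<close>

lemma bounded_bilinear_over_tri: "bounded_bilinear_over sT sT sT mT"
proof -
  note bilinear = A.A.add_left A.A.add_right A.A.scaleR_left A.A.scaleR_right A.A.scale_left A.A.scale_right
    B.A.add_left B.A.add_right B.A.scaleR_left B.A.scaleR_right B.A.scale_left B.A.scale_right
    M.left.add_left M.left.add_right M.left.scaleR_left M.left.scaleR_right M.left.scale_left
    M.left.scale_right M.right.add_left M.right.add_right M.right.scaleR_left M.right.scaleR_right
    M.right.scale_left M.right.scale_right M.left.sp.scale_right_distrib
  obtain K where K: "K \<ge> 0" "\<And>a m. norm (aM a m) \<le> norm a * norm m * K"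
    using M.left.nonneg_bounded by blast
  obtain L where L: "L \<ge> 0" "\<And>m b. norm (bM m b) \<le> norm m * norm b * L"
    using M.right.nonneg_bounded by blast
  \<comment> \<open>The summands 1, \<open>K\<close>, \<open>L\<close>, 1 account for
    \<open>mA\<close>, \<open>aM\<close>, \<open>bM\<close>, \<open>mB\<close>, since no entry
    exceeds the norm of its matrix.\<close>
  have "norm (mT s t) \<le> norm s * norm t * (1 + K + L + 1)" for s t
  proof -
    have le: "norm x * norm y \<le> norm s * norm t"
      if "norm x \<le> norm s" "norm y \<le> norm t" for x :: "'x::real_normed_vector" and y :: "'y::real_normed_vector"
      using that by (intro mult_mono) auto
    have "norm (mT s t) \<le> norm (mA (entry11 s) (entry11 t)) +
        (norm (aM (entry11 s) (entry12 t)) + norm (bM (entry12 s) (entry22 t))) +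
        norm (mB (entry22 s) (entry22 t))"
      unfolding tri_mult_def norm_tri_def tri.sel by (intro add_mono norm_triangle_ineq order_refl)
    also have "\<dots> \<le> norm s * norm t + (norm s * norm t * K + norm s * norm t * L) + norm s * norm t"
      using K(1) L(1)
      by (intro add_mono order_trans[OF A.A.norm_mult_le] order_trans[OF B.A.norm_mult_le]
          order_trans[OF K(2)] order_trans[OF L(2)] mult_right_mono le) (auto simp: norm_tri_def)
    finally show ?thesis by (simp add: algebra_simps)
  qed
  then show ?thesis
    by unfold_locales (auto simp: tri_defs bilinear scaleR_add_right add_ac)
qed

section \<open>The closed ideal \<open>JT\<close> and its entries\<close>

text \<open>Multiplying a generator by an algebra element gives a generator again: by compatibility
  of the actions the factor is absorbed into \<open>mA a c\<close>, \<open>aM a m\<close>,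
  \<open>bM m b\<close> or \<open>mB c b\<close>.\<close>

lemma action_JM:
  assumes "m \<in> JM"
  shows action_JM_left: "aM a m \<in> JM" and action_JM_right: "bM m b \<in> JM"
proof -
  note bs = banach_spaces(3) closed_subspace_J_module[OF banach_spaces(3)]
  have "JM \<subseteq> aM a -` JM"
  proof (rule J_module_minimal)
    show "closed_subspace sM (aM a -` JM)"
      using closed_subspace_vimage[OF bs(1,1) M.left.bounded_linear_over_right bs(2)] .
    show "aM c (lM \<alpha> m) - aM (rA c \<alpha>) m \<in> aM a -` JM" for c m \<alpha>
      using J_module_generator(1)[of aM "mA a c" lM \<alpha> m rA]
      by (simp add: M.left.diff_right M.left.left_assoc A.right_compat)
    show "bM m (lB \<alpha> b) - bM (rM m \<alpha>) b \<in> aM a -` JM" for m b \<alpha>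
      using J_module_generator(2)[of bM "aM a m" lB \<alpha> b rM]
      by (simp add: M.left.diff_right M.middle_assoc compat_right_A)
  qed
  then show "aM a m \<in> JM" using assms by blast
  have "JM \<subseteq> (\<lambda>m. bM m b) -` JM"
  proof (rule J_module_minimal)
    show "closed_subspace sM ((\<lambda>m. bM m b) -` JM)"
      using closed_subspace_vimage[OF bs(1,1) M.right.bounded_linear_over_left bs(2)] .
    show "aM a (lM \<alpha> m) - aM (rA a \<alpha>) m \<in> (\<lambda>m. bM m b) -` JM" for a m \<alpha>
      using J_module_generator(1)[of aM a lM \<alpha> "bM m b" rA]
      by (simp add: M.right.diff_left M.middle_assoc compat_left_B)
    show "bM m (lB \<alpha> c) - bM (rM m \<alpha>) c \<in> (\<lambda>m. bM m b) -` JM" for m c \<alpha>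
      using J_module_generator(2)[of bM m lB \<alpha> "mB c b" rM]
      by (simp add: M.right.diff_left M.right.right_assoc B.left_compat)
  qed
  then show "bM m b \<in> JM" using assms by blast
qed

lemma JM_add: "m \<in> JM \<Longrightarrow> m' \<in> JM \<Longrightarrow> m + m' \<in> JM"
  and JM_neg: "m \<in> JM \<Longrightarrow> - m \<in> JM"
  using closed_subspace_J_module[OF banach_spaces(3), of aM bM rA lB lM rM]
    M.left.sp.subspace_add M.left.sp.subspace_neg
  unfolding closed_subspace_def by blast+

text \<open>A generator of \<open>JA\<close> applied to \<open>m\<close> is the negative of a
  generator of \<open>JM\<close> at \<open>aM b m\<close>, because \<open>compat_left_A\<close>
  moves \<open>\<alpha>\<close> past the action.\<close>

lemma JA_action:
  assumes "a \<in> JA"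
  shows "aM a m \<in> JM"
proof -
  note JM = closed_subspace_J_module[OF banach_spaces(3)]
  \<comment> \<open>Intersecting over all \<open>m\<close> gives a two-sided ideal: right factors
    are absorbed by \<open>m\<close>, left factors by the invariance of \<open>JM\<close>.\<close>
  have "JA \<subseteq> (\<Inter>m. (\<lambda>a. aM a m) -` JM)"
  proof (rule J_algebra_minimal)
    have "closed_subspace sA (\<Inter>m. (\<lambda>a. aM a m) -` JM)"
      using closed_subspace_vimage[OF banach_spaces(1,3) M.left.bounded_linear_over_left JM]
      by (intro closed_subspace_Inter banach_spaces) auto
    then show "closed_ideal sA mA (\<Inter>m. (\<lambda>a. aM a m) -` JM)"
      by (auto simp: closed_ideal_iff M.left.left_assoc action_JM_left)
    show "mA (rA a \<alpha>) b - mA a (lA \<alpha> b) \<in> (\<Inter>m. (\<lambda>a. aM a m) -` JM)" for a b \<alpha>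
    proof -
      have "- (aM a (lM \<alpha> (aM b m)) - aM (rA a \<alpha>) (aM b m)) \<in> JM" for m
        by (intro JM_neg J_module_generator)
      then show ?thesis by (simp add: M.left.diff_left M.left.left_assoc compat_left_A)
    qed
  qed
  then show ?thesis using assms by blast
qed

text \<open>The mirror image: by \<open>compat_right_B\<close>, a generator of \<open>JB\<close>
  becomes the negative of a generator of \<open>JM\<close> at \<open>bM m a\<close>.\<close>

lemma JB_action:
  assumes "b \<in> JB"
  shows "bM m b \<in> JM"
proof -
  note JM = closed_subspace_J_module[OF banach_spaces(3)]
  have "JB \<subseteq> (\<Inter>m. bM m -` JM)"
  proof (rule J_algebra_minimal)
    have "closed_subspace sB (\<Inter>m. bM m -` JM)"
      using closed_subspace_vimage[OF banach_spaces(2,3) M.right.bounded_linear_over_right JM]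
      by (intro closed_subspace_Inter banach_spaces) auto
    then show "closed_ideal sB mB (\<Inter>m. bM m -` JM)"
      by (auto simp: closed_ideal_iff M.right.right_assoc action_JM_right)
    show "mB (rB a \<alpha>) b - mB a (lB \<alpha> b) \<in> (\<Inter>m. bM m -` JM)" for a b \<alpha>
    proof -
      have "- (bM (bM m a) (lB \<alpha> b) - bM (rM (bM m a) \<alpha>) b) \<in> JM" for m
        by (intro JM_neg J_module_generator)
      then show ?thesis by (simp add: M.right.diff_right M.right.right_assoc compat_right_B)
    qed
  qed
  then show ?thesis using assms by blast
qed

lemma closed_subspace_JT: "closed_subspace sT JT"
  using closed_ideal_J_algebra[OF banach_space_tri] by (auto simp: closed_ideal_iff)

lemma mT_JT: "t \<in> JT \<Longrightarrow> mT s t \<in> JT" "t \<in> JT \<Longrightarrow> mT t s \<in> JT"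
  using closed_ideal_J_algebra[OF banach_space_tri, of mT "tri_left_act lA lM lB"
      "tri_right_act rA rM rB"]
  unfolding closed_ideal_iff by blast+

text \<open>Setting entries to zero isolates the generators of one corner. For such instances the
  variables come in the order \<open>a\<close>, \<open>\<alpha>\<close>, \<open>a'\<close>,
  \<open>m'\<close>, \<open>m\<close>, \<open>b'\<close>, \<open>b\<close>.\<close>

lemma JT_generator:
  "Tri (mA (rA a \<alpha>) a' - mA a (lA \<alpha> a'))
     (aM (rA a \<alpha>) m' + bM (rM m \<alpha>) b' - (aM a (lM \<alpha> m') + bM m (lB \<alpha> b')))
     (mB (rB b \<alpha>) b' - mB b (lB \<alpha> b')) \<in> JT"
  using J_algebra_generator[of mT "tri_right_act rA rM rB" "Tri a m b" "Diag \<alpha>" "Tri a' m' b'"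
      "tri_left_act lA lM lB" sT]
  by (simp add: tri_defs)

lemmas zero_simps = A.A.zero_left A.A.zero_right B.A.zero_left B.A.zero_right M.left.zero_left
  M.left.zero_right M.right.zero_left M.right.zero_right A.left.zero_right A.right.zero_left
  B.left.zero_right B.right.zero_left MR.left.zero_right MR.right.zero_left

lemma inj11_JA: "inj11 ` JA \<subseteq> JT"
proof -
  have "JA \<subseteq> inj11 -` JT"
  proof (rule J_algebra_minimal)
    \<comment> \<open>\<open>inj11\<close> is multiplicative, so multiplying by
      \<open>inj11 x\<close> inside \<open>JT\<close> makes the preimage an ideal.\<close>
    have "inj11 (mA x a) \<in> JT" "inj11 (mA a x) \<in> JT" if "inj11 a \<in> JT" for a x
      using mT_JT[OF that, of "inj11 x"] by (simp_all add: tri_mult_def zero_simps)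
    then show "closed_ideal sA mA (inj11 -` JT)"
      using closed_subspace_vimage[OF banach_spaces(1) banach_space_tri inj11 closed_subspace_JT]
      by (simp add: closed_ideal_iff)
    show "mA (rA a \<alpha>) b - mA a (lA \<alpha> b) \<in> inj11 -` JT" for a b \<alpha>
      using JT_generator[of a \<alpha> b 0 0 0 0] by (simp add: zero_simps)
  qed
  then show ?thesis by blast
qed

lemma inj22_JB: "inj22 ` JB \<subseteq> JT"
proof -
  have "JB \<subseteq> inj22 -` JT"
  proof (rule J_algebra_minimal)
    have "inj22 (mB x b) \<in> JT" "inj22 (mB b x) \<in> JT" if "inj22 b \<in> JT" for b x
      using mT_JT[OF that, of "inj22 x"] by (simp_all add: tri_mult_def zero_simps)
    then show "closed_ideal sB mB (inj22 -` JT)"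
      using closed_subspace_vimage[OF banach_spaces(2) banach_space_tri inj22 closed_subspace_JT]
      by (simp add: closed_ideal_iff)
    show "mB (rB a \<alpha>) b - mB a (lB \<alpha> b) \<in> inj22 -` JT" for a b \<alpha>
      using JT_generator[of 0 \<alpha> 0 0 0 b a] by (simp add: zero_simps)
  qed
  then show ?thesis by blast
qed

lemma inj12_JM: "inj12 ` JM \<subseteq> JT"
proof -
  interpret T: banach_space sT by (rule banach_space_tri)
  \<comment> \<open>Generators of \<open>JM\<close> have the sign opposite to the upper right entry
    in \<open>JT_generator\<close>.\<close>
  have neg: "- t \<in> JT" if "t \<in> JT" for t
    using closed_subspace_JT that T.subspace_neg by (auto simp: closed_subspace_def)
  have "JM \<subseteq> inj12 -` JT"
  proof (rule J_module_minimal)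
    show "closed_subspace sM (inj12 -` JT)"
      using closed_subspace_vimage[OF banach_spaces(3) banach_space_tri inj12 closed_subspace_JT] .
    show "aM a (lM \<alpha> m) - aM (rA a \<alpha>) m \<in> inj12 -` JT" for a m \<alpha>
      using neg[OF JT_generator[of a \<alpha> 0 m 0 0 0]] by (simp add: zero_simps uminus_tri_def)
    show "bM m (lB \<alpha> b) - bM (rM m \<alpha>) b \<in> inj12 -` JT" for m b \<alpha>
      using neg[OF JT_generator[of 0 \<alpha> 0 0 m b 0]] by (simp add: zero_simps uminus_tri_def)
  qed
  then show ?thesis by blast
qed

text \<open>The matrices with entries in \<open>JA\<close>, \<open>JM\<close> and \<open>JB\<close>
  form a closed ideal containing the generators of \<open>JT\<close>, hence \<open>JT\<close>
  itself.\<close>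

lemma entries_JT:
  shows entry11_JT: "entry11 ` JT \<subseteq> JA"
    and entry12_JT: "entry12 ` JT \<subseteq> JM"
    and entry22_JT: "entry22 ` JT \<subseteq> JB"
proof -
  let ?I = "\<Inter>{entry11 -` JA, entry12 -` JM, entry22 -` JB}"
  have ideals: "closed_ideal sA mA JA" "closed_ideal sB mB JB"
    by (rule closed_ideal_J_algebra banach_spaces)+
  then have cs: "closed_subspace sA JA" "closed_subspace sM JM" "closed_subspace sB JB"
    by (auto simp: closed_ideal_iff closed_subspace_J_module[OF banach_spaces(3)])
  have "JT \<subseteq> ?I"
  proof (rule J_algebra_minimal)
    have subspace: "closed_subspace sT ?I"
      using closed_subspace_vimage[OF banach_space_tri banach_spaces(1) entry11 cs(1)]
        closed_subspace_vimage[OF banach_space_tri banach_spaces(3) entry12 cs(2)]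
        closed_subspace_vimage[OF banach_space_tri banach_spaces(2) entry22 cs(3)]
      by (intro closed_subspace_Inter banach_space_tri) auto
    \<comment> \<open>The upper right entry of a product mixes the corners: one summand is in
      \<open>JM\<close> by its invariance, the other by \<open>JB_action\<close> for
      \<open>mT s t\<close> and by \<open>JA_action\<close> for \<open>mT t s\<close>.\<close>
    have mult: "mT s t \<in> ?I" "mT t s \<in> ?I" if "t \<in> ?I" for s t
      using that ideals
      by (simp_all add: tri_mult_def closed_ideal_iff JM_add action_JM JA_action JB_action)
    show "closed_ideal sT mT ?I"
      unfolding closed_ideal_iff by (intro conjI ballI allI subspace mult)
    show "mT (tri_right_act rA rM rB s \<alpha>) t - mT s (tri_left_act lA lM lB \<alpha> t) \<in> ?I" for s t \<alpha>
    proof -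
      let ?\<alpha> = "diag_entry \<alpha>"
      \<comment> \<open>Regroups the upper right entry into one generator of \<open>JM\<close> of
        each kind, up to sign.\<close>
      have eq: "x + y - (x' + y') = - (x' - x + (y' - y))" for x y x' y' :: 'm by simp
      have "aM (rA (entry11 s) ?\<alpha>) (entry12 t) + bM (rM (entry12 s) ?\<alpha>) (entry22 t) -
        (aM (entry11 s) (lM ?\<alpha> (entry12 t)) + bM (entry12 s) (lB ?\<alpha> (entry22 t))) \<in> JM"
        unfolding eq by (intro JM_neg JM_add J_module_generator)
      then show ?thesis
        by (simp add: tri_defs J_algebra_generator)
    qed
  qed
  then show "entry11 ` JT \<subseteq> JA" "entry12 ` JT \<subseteq> JM" "entry22 ` JT \<subseteq> JB" by auto
qed

section \<open>Transfer of regularity between \<open>T\<close> and its corners\<close>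

lemmas regular_iff =
  module_arens_regular_iff[OF banach_space_tri bounded_bilinear_over_tri]
  module_arens_regular_iff[OF banach_spaces(1) bilinear_overs(1)]
  module_arens_regular_iff[OF banach_spaces(2) bilinear_overs(2)]
  act_module_regularly_iff[OF banach_spaces bilinear_overs(3,4)]

text \<open>Each of the four products is \<open>\<theta>\<close> of a product in \<open>T\<close>.
  Second adjoints push \<open>\<Gamma>\<close> and \<open>\<Phi>\<close> into the bidual of
  \<open>T\<close>, and \<open>\<theta>\<close> pulls \<open>h\<close> back to the annihilator of
  \<open>JT\<close>, where regularity applies.\<close>

lemma regular_tri_corner:
  assumes reg: "module_arens_regular sT mT (tri_left_act lA lM lB) (tri_right_act rA rM rB)"
    and \<phi>: "bounded_linear_over sX sT \<phi>" and \<psi>: "bounded_linear_over sY sT \<psi>"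
    and \<theta>: "bounded_linear_over sT sZ \<theta>" "\<theta> ` JT \<subseteq> J"
    and p: "\<And>x y. p x y = \<theta> (mT (\<phi> x) (\<psi> y))"
    and \<Gamma>: "\<Gamma> \<in> bidual_space sX" and \<Phi>: "\<Phi> \<in> bidual_space sY" and h: "h \<in> annihilator sZ J"
  shows "limits_commute \<Gamma> \<Phi> (\<lambda>x y. h (p x y))"
proof -
  have h\<theta>: "(\<lambda>t. h (\<theta> t)) \<in> annihilator sT JT" by (rule annihilator_compose[OF h \<theta>])
  note form = bounded_bilinear_form_compose[OF bounded_bilinear_over_tri annihilator_in_dual[OF h\<theta>]
      bounded_linear_over_id bounded_linear_over_id]
  have "limits_commute (bidual_map sT \<phi> \<Gamma>) (bidual_map sT \<psi> \<Phi>) (\<lambda>s t. h (\<theta> (mT s t)))"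
    using reg[unfolded regular_iff, rule_format,
        OF bidual_map_in_bidual[OF \<Gamma> \<phi>] bidual_map_in_bidual[OF \<Phi> \<psi>] h\<theta>] .
  then show ?thesis
    by (simp add: limits_commute_bidual_map[OF \<Gamma> \<Phi> \<phi> \<psi> form] p)
qed

lemma regular_tri_imp_regular:
  assumes reg: "module_arens_regular sT mT (tri_left_act lA lM lB) (tri_right_act rA rM rB)"
  shows "module_arens_regular sA mA lA rA" "module_arens_regular sB mB lB rB"
    "act_module_regularly sA sB sM aM bM rA lB lM rM"
proof -
  note corner = regular_tri_corner[OF reg]
  show "module_arens_regular sA mA lA rA"
    unfolding regular_iff
  proof (intro ballI)
    show "limits_commute \<Gamma> \<Phi> (\<lambda>x y. h (mA x y))"
      if "\<Gamma> \<in> bidual_space sA" "\<Phi> \<in> bidual_space sA" "h \<in> annihilator sA JA" for \<Gamma> \<Phi> h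
      by (rule corner[OF inj11 inj11 entry11 entry11_JT _ that])
        (simp add: tri_mult_def)
  qed
  show "module_arens_regular sB mB lB rB"
    unfolding regular_iff
  proof (intro ballI)
    show "limits_commute \<Gamma> \<Phi> (\<lambda>x y. h (mB x y))"
      if "\<Gamma> \<in> bidual_space sB" "\<Phi> \<in> bidual_space sB" "h \<in> annihilator sB JB" for \<Gamma> \<Phi> h
      by (rule corner[OF inj22 inj22 entry22 entry22_JT _ that])
        (simp add: tri_mult_def)
  qed
  show "act_module_regularly sA sB sM aM bM rA lB lM rM"
    unfolding regular_iff
  proof (intro ballI conjI)
    fix \<Phi> h
    assume \<Phi>: "\<Phi> \<in> bidual_space sM" and h: "h \<in> annihilator sM JM"
    \<comment> \<open>\<open>aM\<close> is the upper right entry of \<open>inj11\<close> times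
      \<open>inj12\<close>, and \<open>bM\<close> that of \<open>inj12\<close> times
      \<open>inj22\<close>.\<close>
    show "limits_commute \<Gamma> \<Phi> (\<lambda>a m. h (aM a m))" if "\<Gamma> \<in> bidual_space sA" for \<Gamma>
      by (rule corner[OF inj11 inj12 entry12 entry12_JT _ that \<Phi> h])
        (simp add: tri_mult_def zero_simps)
    show "limits_commute \<Phi> \<Psi> (\<lambda>m b. h (bM m b))" if "\<Psi> \<in> bidual_space sB" for \<Psi>
      by (rule corner[OF inj12 inj22 entry12 entry12_JT _ \<Phi> that h])
        (simp add: tri_mult_def zero_simps)
  qed
qed

text \<open>A functional on \<open>T\<close> is the sum of its restrictions to the corners, so
  \<open>h (mT s t)\<close> is a sum of four forms, each factoring through entries of
  \<open>s\<close> and \<open>t\<close> and handled by one of the hypotheses.\<close>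

lemma regular_imp_regular_tri:
  assumes A: "module_arens_regular sA mA lA rA" and B: "module_arens_regular sB mB lB rB"
    and M: "act_module_regularly sA sB sM aM bM rA lB lM rM"
  shows "module_arens_regular sT mT (tri_left_act lA lM lB) (tri_right_act rA rM rB)"
  unfolding regular_iff
proof (intro ballI)
  fix \<Gamma> \<Phi> h
  assume \<Gamma>: "\<Gamma> \<in> bidual_space sT" and \<Phi>: "\<Phi> \<in> bidual_space sT" and h: "h \<in> annihilator sT JT"
  note ann = annihilator_compose[OF h inj11 inj11_JA] annihilator_compose[OF h inj22 inj22_JB]
    annihilator_compose[OF h inj12 inj12_JM]
  note dual = ann[THEN annihilator_in_dual]
  note id = bounded_linear_over_id bounded_linear_over_id
  note forms = bounded_bilinear_form_compose[OF bilinear_overs(1) dual(1) id]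
    bounded_bilinear_form_compose[OF bilinear_overs(3) dual(3) id]
    bounded_bilinear_form_compose[OF bilinear_overs(4) dual(3) id]
    bounded_bilinear_form_compose[OF bilinear_overs(2) dual(2) id]
  \<comment> \<open>The same four forms pulled back to \<open>T\<close>, where they are added
    up.\<close>
  note formsT = bounded_bilinear_form_compose[OF bilinear_overs(1) dual(1) entry11 entry11]
    bounded_bilinear_form_compose[OF bilinear_overs(3) dual(3) entry11 entry12]
    bounded_bilinear_form_compose[OF bilinear_overs(4) dual(3) entry12 entry22]
    bounded_bilinear_form_compose[OF bilinear_overs(2) dual(2) entry22 entry22]
  note map = bidual_map_in_bidual[OF \<Gamma>] bidual_map_in_bidual[OF \<Phi>]
  \<comment> \<open>The hypotheses are applied to the images of \<open>\<Gamma>\<close> and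
    \<open>\<Phi>\<close> under second adjoints of the entry maps; this direction returns to
    \<open>\<Gamma>\<close> and \<open>\<Phi>\<close>.\<close>
  note commute = limits_commute_bidual_map[OF \<Gamma> \<Phi>, THEN iffD1]
  have 1: "limits_commute \<Gamma> \<Phi> (\<lambda>s t. h (inj11 (mA (entry11 s) (entry11 t))))"
    using A[unfolded regular_iff, rule_format, OF map(1)[OF entry11] map(2)[OF entry11] ann(1)]
    by (rule commute[OF entry11 entry11 forms(1)])
  have 2: "limits_commute \<Gamma> \<Phi> (\<lambda>s t. h (inj12 (aM (entry11 s) (entry12 t))))"
    using M[unfolded regular_iff, rule_format, THEN conjunct1, rule_format, OF map(2)[OF entry12]
        ann(3) map(1)[OF entry11]]
    by (rule commute[OF entry11 entry12 forms(2)])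
  have 3: "limits_commute \<Gamma> \<Phi> (\<lambda>s t. h (inj12 (bM (entry12 s) (entry22 t))))"
    using M[unfolded regular_iff, rule_format, THEN conjunct2, rule_format, OF map(1)[OF entry12]
        ann(3) map(2)[OF entry22]]
    by (rule commute[OF entry12 entry22 forms(3)])
  have 4: "limits_commute \<Gamma> \<Phi> (\<lambda>s t. h (inj22 (mB (entry22 s) (entry22 t))))"
    using B[unfolded regular_iff, rule_format, OF map(1)[OF entry22] map(2)[OF entry22] ann(2)]
    by (rule commute[OF entry22 entry22 forms(4)])
  interpret h: bounded_linear h by (rule dual_spaceD(1)[OF annihilator_in_dual[OF h]])
  \<comment> \<open>The grouping into two pairs matches the three applications of additivity that
    follow.\<close>
  have "h (mT s t) = h (inj11 (mA (entry11 s) (entry11 t))) + h (inj12 (aM (entry11 s) (entry12 t))) +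
      (h (inj12 (bM (entry12 s) (entry22 t))) + h (inj22 (mB (entry22 s) (entry22 t))))" for s t
    by (simp add: tri_mult_def plus_tri_def flip: h.add)
  then show "limits_commute \<Gamma> \<Phi> (\<lambda>s t. h (mT s t))"
    using limits_commute_add[OF \<Gamma> \<Phi> bounded_bilinear_form_add[OF formsT(1,2)]
        bounded_bilinear_form_add[OF formsT(3,4)]
        limits_commute_add[OF \<Gamma> \<Phi> formsT(1,2) 1 2] limits_commute_add[OF \<Gamma> \<Phi> formsT(3,4) 3 4]]
    by simp
qed

end

theorem theorem3p1:
  fixes sR :: "'k::real_normed_field \<Rightarrow> 'r::banach \<Rightarrow> 'r" and mR :: "'r \<Rightarrow> 'r \<Rightarrow> 'r"
    and sA :: "'k \<Rightarrow> 'a::banach \<Rightarrow> 'a" and mA :: "'a \<Rightarrow> 'a \<Rightarrow> 'a"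
    and lA :: "'r \<Rightarrow> 'a \<Rightarrow> 'a" and rA :: "'a \<Rightarrow> 'r \<Rightarrow> 'a"
    and sB :: "'k \<Rightarrow> 'b::banach \<Rightarrow> 'b" and mB :: "'b \<Rightarrow> 'b \<Rightarrow> 'b"
    and lB :: "'r \<Rightarrow> 'b \<Rightarrow> 'b" and rB :: "'b \<Rightarrow> 'r \<Rightarrow> 'b"
    and sM :: "'k \<Rightarrow> 'm::banach \<Rightarrow> 'm"
    and aM :: "'a \<Rightarrow> 'm \<Rightarrow> 'm" and bM :: "'m \<Rightarrow> 'b \<Rightarrow> 'm"
    and lM :: "'r \<Rightarrow> 'm \<Rightarrow> 'm" and rM :: "'m \<Rightarrow> 'r \<Rightarrow> 'm"
  assumes "triangular_setting sR mR sA mA lA rA sB mB lB rB sM aM bM lM rM"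
  shows "module_arens_regular (tri_scale sA sM sB) (tri_mult mA mB aM bM)
           (tri_left_act lA lM lB) (tri_right_act rA rM rB)
         \<longleftrightarrow> module_arens_regular sA mA lA rA \<and> module_arens_regular sB mB lB rB \<and>
             act_module_regularly sA sB sM aM bM rA lB lM rM"
proof -
  interpret triangular_setting sR mR sA mA lA rA sB mB lB rB sM aM bM lM rM by fact
  show ?thesis
    using regular_tri_imp_regular regular_imp_regular_tri by blast
qed

end
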